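(* Let $\alpha\in(0,1)$ and let $(\phi^n)_{0\le n\le N}$ be a solution of the stabilized L1 scheme $$\bar\partial_{n+1}^\alpha \phi = \gamma\,\mathcal G\left(\mathcal L\phi^{n+1}+\delta_\phi E_1(\phi^n)+\widetilde{\mathcal L}(\phi^{n+1}-\phi^n)\right),\qquad 0\le n\le N-1,$$ for the time-fractional Allen--Cahn, Cahn--Hilliard, or MBE (without slope selection) model; in the Allen--Cahn case assume $\|\phi^0\|_\infty\le 1$. Let $E^n=E(\phi^n)$ and define the discrete weighted energy $$\widetilde E^n=E^0+\Delta t\sum_{m=1}^n D^m,\qquad D^m=\frac{1}{\Gamma(\alpha)\,t_m}\sum_{k=1}^m t_k^\alpha\, b_{m-k}\,\bar\partial_k E .$$ Then $$\widetilde E^n\le\widetilde E^{n-1}\qquad\text{for all }1\le n\le N.$$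
   Context: Let $\gamma>0$, $\varepsilon>0$, $T>0$, $N\ge1$ an integer, $\Delta t=T/N$, $t_n=n\Delta t$. $\Omega$ is a bounded rectangular box with periodic boundary conditions; $\langle\cdot,\cdot\rangle$ and $\|\cdot\|$ are the $L^2(\Omega)$ inner product and norm, $\|\cdot\|_\infty$ is the sup norm. Each $\phi^n$ is a periodic function on $\Omega$, smooth enough that all expressions make sense. An empty sum is $0$, so $\widetilde E^0=E^0$. Discrete derivatives. For a sequence $(v^n)_{0\le n\le N}$ (of functions or of real numbers): $\bar\partial_k v=\frac{v^k-v^{k-1}}{\Delta t}$ for $k\ge1$, and the L1 discrete Caputo derivative is $\bar\partial_n^\alpha v=\sum_{j=1}^n b_{n-j}\bar\partial_j v$ for $1\le n\le N$, where $b_j=\frac{\Delta t^{1-\alpha}}{\Gamma(2-\alpha)}\left[(j+1)^{1-\alpha}-j^{1-\alpha}\right]$, $j\ge0$. Models. The energy is split as $E(\phi)=\frac12\langle\phi,\mathcal L\phi\rangle+E_1(\phi)$, and $\delta_\phi E_1$ is the variational derivative of $E_1$ in $L^2$. (i) Allen--Cahn (AC): $\mathcal G=-1$, $\mathcal L=-\varepsilon^2\Delta$, $E_1(\phi)=\int_\Omega F(\phi)\,dx$ with $F(\phi)=\frac14(1-\phi^2)^2$, so $\delta_\phi E_1(\phi)=\phi^3-\phi$; $\widetilde{\mathcal L}=S$ with constant $S\ge2$. (ii) Cahn--Hilliard (CH): $\mathcal G=\Delta$ (with inverse $\mathcal G^{-1}$ on mean-zero functions), $\mathcal L=-\varepsilon^2\Delta$,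 $E_1(\phi)=\int_\Omega F(\phi)\,dx$, $\delta_\phi E_1(\phi)=F'(\phi)$, where $F$ is a truncated ($C^2$) version of the double well $\frac14(1-\phi^2)^2$ such that $\sup_{s\in\mathbb R}|F''(s)|\le L$ for some constant $L>0$; $\widetilde{\mathcal L}=S$ with constant $S\ge L/2$. (iii) MBE without slope selection: $\mathcal G=-1$, $\mathcal L=\varepsilon^2\Delta^2$, $E_1(\phi)=-\frac12\int_\Omega\ln(1+|\nabla\phi|^2)\,dx$, $\delta_\phi E_1(\phi)=\nabla\cdot\frac{\nabla\phi}{1+|\nabla\phi|^2}$; $\widetilde{\mathcal L}=-S\Delta$ with constant $S\ge\frac1{16}$. *)

theory Defs
  imports "HOL-Analysis.Analysis"
begin

section \<open>Vector calculus on a Euclidean space\<close>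

definition gradient :: "('a::euclidean_space \<Rightarrow> real) \<Rightarrow> 'a \<Rightarrow> 'a" where
  "gradient f x = (\<Sum>e\<in>Basis. frechet_derivative f (at x) e *\<^sub>R e)"

definition divergence :: "('a::euclidean_space \<Rightarrow> 'a) \<Rightarrow> 'a \<Rightarrow> real" where
  "divergence v x = (\<Sum>e\<in>Basis. frechet_derivative v (at x) e \<bullet> e)"

definition laplacian :: "('a::euclidean_space \<Rightarrow> real) \<Rightarrow> 'a \<Rightarrow> real" where
  "laplacian f = divergence (gradient f)"

text \<open>\<open>Ck k f\<close>: \<open>f\<close> is \<open>k\<close> times continuously differentiable on the whole space.\<close>

primrec Ck :: "nat \<Rightarrow> ('a::euclidean_space \<Rightarrow> real) \<Rightarrow> bool" where
  "Ck 0 f \<longleftrightarrow> continuous_on UNIV f"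
| "Ck (Suc k) f \<longleftrightarrow> (\<forall>x. f differentiable (at x)) \<and>
     (\<forall>e\<in>Basis. Ck k (\<lambda>x. frechet_derivative f (at x) e))"


section \<open>Periodic functions on the box \<open>\<Omega> = cbox a b\<close>\<close>

text \<open>A function on the box with periodic boundary conditions is represented by its periodic
  extension to the whole space, so that \<open>Ck\<close> and the differential operators also respect the
  matching of opposite faces.\<close>

definition box_periodic :: "'a::euclidean_space \<Rightarrow> 'a \<Rightarrow> ('a \<Rightarrow> real) \<Rightarrow> bool" where
  "box_periodic a b f \<longleftrightarrow> (\<forall>e\<in>Basis. \<forall>x. f (x + ((b - a) \<bullet> e) *\<^sub>R e) = f x)"

definition l2_inner :: "'a::euclidean_space \<Rightarrow> 'a \<Rightarrow> ('a \<Rightarrow> real) \<Rightarrow> ('a \<Rightarrow> real) \<Rightarrow> real" where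
  "l2_inner a b f g = integral (cbox a b) (\<lambda>x. f x * g x)"

definition sup_norm :: "'a::euclidean_space \<Rightarrow> 'a \<Rightarrow> ('a \<Rightarrow> real) \<Rightarrow> real" where
  "sup_norm a b f = (SUP x\<in>cbox a b. \<bar>f x\<bar>)"


section \<open>Discrete derivatives\<close>

definition bdiff :: "real \<Rightarrow> (nat \<Rightarrow> real) \<Rightarrow> nat \<Rightarrow> real" where
  "bdiff dt v k = (v k - v (k - 1)) / dt"

definition L1_coeff :: "real \<Rightarrow> real \<Rightarrow> nat \<Rightarrow> real" where
  "L1_coeff \<alpha> dt j = dt powr (1 - \<alpha>) / Gamma (2 - \<alpha>) *
     ((real j + 1) powr (1 - \<alpha>) - real j powr (1 - \<alpha>))"

definition L1_caputo :: "real \<Rightarrow> real \<Rightarrow> (nat \<Rightarrow> real) \<Rightarrow> nat \<Rightarrow> real" where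
  "L1_caputo \<alpha> dt v n = (\<Sum>j=1..n. L1_coeff \<alpha> dt (n - j) * bdiff dt v j)"


section \<open>The three phase-field models\<close>

definition double_well :: "real \<Rightarrow> real" where
  "double_well s = (1 - s\<^sup>2)\<^sup>2 / 4"

text \<open>The potential is an arbitrary \<open>C\<^sup>2\<close> function that coincides with the double well on some
  interval \<open>[-R, R]\<close> and satisfies \<open>\<bar>F''\<bar> \<le> L\<close> everywhere; the way the double well is
  continued beyond \<open>[-R, R]\<close> is left open.\<close>

definition truncated_double_well :: "(real \<Rightarrow> real) \<Rightarrow> real \<Rightarrow> bool" where
  "truncated_double_well F L \<longleftrightarrow>
     (\<forall>s. F field_differentiable (at s)) \<and>
     (\<forall>s. deriv F field_differentiable (at s)) \<and>
     continuous_on UNIV (deriv (deriv F)) \<and>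
     (\<exists>R>0. \<forall>s. \<bar>s\<bar> \<le> R \<longrightarrow> F s = double_well s) \<and>
     (\<forall>s. \<bar>deriv (deriv F) s\<bar> \<le> L)"

text \<open>\<open>Cahn_Hilliard F L\<close> carries the truncated potential \<open>F\<close> and the bound \<open>L\<close> on \<open>F''\<close>.
  \<open>MBE\<close> is molecular beam epitaxy without slope selection.\<close>

datatype model = Allen_Cahn | Cahn_Hilliard "real \<Rightarrow> real" real | MBE

primrec admissible :: "model \<Rightarrow> real \<Rightarrow> bool" where
  "admissible Allen_Cahn S \<longleftrightarrow> S \<ge> 2"
| "admissible (Cahn_Hilliard F L) S \<longleftrightarrow> L > 0 \<and> truncated_double_well F L \<and> S \<ge> L / 2"
| "admissible MBE S \<longleftrightarrow> S \<ge> 1 / 16"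

primrec op_G :: "model \<Rightarrow> ('a::euclidean_space \<Rightarrow> real) \<Rightarrow> 'a \<Rightarrow> real" where
  "op_G Allen_Cahn f = (\<lambda>x. - f x)"
| "op_G (Cahn_Hilliard F L) f = laplacian f"
| "op_G MBE f = (\<lambda>x. - f x)"

primrec op_L :: "model \<Rightarrow> real \<Rightarrow> ('a::euclidean_space \<Rightarrow> real) \<Rightarrow> 'a \<Rightarrow> real" where
  "op_L Allen_Cahn \<epsilon> f = (\<lambda>x. - (\<epsilon>\<^sup>2) * laplacian f x)"
| "op_L (Cahn_Hilliard F L) \<epsilon> f = (\<lambda>x. - (\<epsilon>\<^sup>2) * laplacian f x)"
| "op_L MBE \<epsilon> f = (\<lambda>x. \<epsilon>\<^sup>2 * laplacian (laplacian f) x)"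

primrec energy_1 :: "'a::euclidean_space \<Rightarrow> 'a \<Rightarrow> model \<Rightarrow> ('a \<Rightarrow> real) \<Rightarrow> real" where
  "energy_1 a b Allen_Cahn f = integral (cbox a b) (\<lambda>x. double_well (f x))"
| "energy_1 a b (Cahn_Hilliard F L) f = integral (cbox a b) (\<lambda>x. F (f x))"
| "energy_1 a b MBE f = - (1 / 2) * integral (cbox a b) (\<lambda>x. ln (1 + (norm (gradient f x))\<^sup>2))"

primrec var_deriv_1 :: "model \<Rightarrow> ('a::euclidean_space \<Rightarrow> real) \<Rightarrow> 'a \<Rightarrow> real" where
  "var_deriv_1 Allen_Cahn f = (\<lambda>x. f x ^ 3 - f x)"
| "var_deriv_1 (Cahn_Hilliard F L) f = (\<lambda>x. deriv F (f x))"
| "var_deriv_1 MBE f = divergence (\<lambda>x. gradient f x /\<^sub>R (1 + (norm (gradient f x))\<^sup>2))"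

text \<open>\<open>op_stab\<close> is the stabilizing operator, written \<open>\<L>\<close> with a tilde on top.\<close>

primrec op_stab :: "model \<Rightarrow> real \<Rightarrow> ('a::euclidean_space \<Rightarrow> real) \<Rightarrow> 'a \<Rightarrow> real" where
  "op_stab Allen_Cahn S f = (\<lambda>x. S * f x)"
| "op_stab (Cahn_Hilliard F L) S f = (\<lambda>x. S * f x)"
| "op_stab MBE S f = (\<lambda>x. - S * laplacian f x)"

definition energy :: "'a::euclidean_space \<Rightarrow> 'a \<Rightarrow> model \<Rightarrow> real \<Rightarrow> ('a \<Rightarrow> real) \<Rightarrow> real" where
  "energy a b M \<epsilon> f = 1 / 2 * l2_inner a b f (op_L M \<epsilon> f) + energy_1 a b M f"


section \<open>The stabilized L1 scheme\<close>

definition chem_potential ::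
    "model \<Rightarrow> real \<Rightarrow> real \<Rightarrow> (nat \<Rightarrow> 'a::euclidean_space \<Rightarrow> real) \<Rightarrow> nat \<Rightarrow> 'a \<Rightarrow> real" where
  "chem_potential M \<epsilon> S \<phi> n = (\<lambda>x. op_L M \<epsilon> (\<phi> (Suc n)) x + var_deriv_1 M (\<phi> n) x
     + op_stab M S (\<lambda>y. \<phi> (Suc n) y - \<phi> n y) x)"

text \<open>Orders of the differential operators \<open>\<L>\<close> and \<open>\<G>\<close>. A solution is classical: each
  \<open>\<phi>\<^sup>n\<close> and each argument of \<open>\<G>\<close> has as many continuous derivatives as are needed to
  apply the operator. For Cahn--Hilliard, requiring \<open>\<phi>\<^sup>n \<in> C\<^sup>4\<close> instead would not be
  enough to form \<open>\<Delta> F'(\<phi>\<^sup>n)\<close>, since \<open>F\<close> is only \<open>C\<^sup>2\<close>.\<close>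

primrec order_L :: "model \<Rightarrow> nat" where
  "order_L Allen_Cahn = 2"
| "order_L (Cahn_Hilliard F L) = 2"
| "order_L MBE = 4"

primrec order_G :: "model \<Rightarrow> nat" where
  "order_G Allen_Cahn = 0"
| "order_G (Cahn_Hilliard F L) = 2"
| "order_G MBE = 0"

definition L1_scheme_solution ::
    "'a::euclidean_space \<Rightarrow> 'a \<Rightarrow> model \<Rightarrow> real \<Rightarrow> real \<Rightarrow> real \<Rightarrow> real \<Rightarrow> real \<Rightarrow> nat
       \<Rightarrow> (nat \<Rightarrow> 'a \<Rightarrow> real) \<Rightarrow> bool" where
  "L1_scheme_solution a b M \<alpha> \<gamma> \<epsilon> S dt N \<phi> \<longleftrightarrow>
     (\<forall>n\<le>N. box_periodic a b (\<phi> n) \<and> Ck (order_L M) (\<phi> n)) \<and>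
     (\<forall>n<N. Ck (order_G M) (chem_potential M \<epsilon> S \<phi> n)) \<and>
     (\<forall>n<N. \<forall>x. L1_caputo \<alpha> dt (\<lambda>k. \<phi> k x) (Suc n)
        = \<gamma> * op_G M (chem_potential M \<epsilon> S \<phi> n) x)"


section \<open>The discrete weighted energy\<close>

definition weighted_D :: "real \<Rightarrow> real \<Rightarrow> (nat \<Rightarrow> real) \<Rightarrow> nat \<Rightarrow> real" where
  "weighted_D \<alpha> dt E m = 1 / (Gamma \<alpha> * (real m * dt)) *
     (\<Sum>k=1..m. (real k * dt) powr \<alpha> * L1_coeff \<alpha> dt (m - k) * bdiff dt E k)"

definition weighted_energy :: "real \<Rightarrow> real \<Rightarrow> (nat \<Rightarrow> real) \<Rightarrow> nat \<Rightarrow> real" where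
  "weighted_energy \<alpha> dt E n = E 0 + dt * (\<Sum>m=1..n. weighted_D \<alpha> dt E m)"

end

theory Submission
  imports Defs
begin

text \<open>
  Each increment of the weighted energy is \<open>\<Delta>t D\<^sup>n\<close>, so the claim is that every \<open>D\<^sup>m\<close> is
  nonpositive. Two facts combine to give this.

  First, the stabilization makes one step of the scheme behave like a gradient flow: with
  \<open>\<delta>\<^sup>k = \<phi>\<^sup>k - \<phi>\<^sup>k\<^sup>-\<^sup>1\<close> and \<open>\<mu>\<^sup>k\<close> the argument of \<open>\<G>\<close> in the \<open>k\<close>th step,
  \<open>E\<^sup>k - E\<^sup>k\<^sup>-\<^sup>1 \<le> \<langle>\<delta>\<^sup>k, \<mu>\<^sup>k\<rangle>\<close> (\<open>energy_le\<close>). The quadratic part of the energy is convex and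
  treated implicitly; the Taylor remainder of the explicit nonlinear part is absorbed by the
  stabilizing term, because the second derivative of the potential is bounded: by \<open>2\<close> on \<open>[-1, 1]\<close>
  for Allen--Cahn, where the scheme satisfies a maximum principle
  (\<open>Allen_Cahn_max_principle\<close>), by \<open>L\<close> for Cahn--Hilliard, and by \<open>1/8\<close> for the logarithmic
  potential of MBE.

  Second, for \<open>\<G> = -1\<close> the scheme expresses \<open>\<mu>\<^sup>k\<close> through the increments, so the sum of
  \<open>t\<^sub>k\<^sup>\<alpha> b\<^sub>m\<^sub>-\<^sub>k \<langle>\<delta>\<^sup>k, \<mu>\<^sup>k\<rangle>\<close> over \<open>k\<close> becomes a negative multiple of the quadratic form with the
  triangular kernel \<open>t\<^sub>k\<^sup>\<alpha> b\<^sub>m\<^sub>-\<^sub>k b\<^sub>k\<^sub>-\<^sub>j\<close>, and this form is nonnegative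
  (\<open>weighted_L1_form_nonneg\<close>). The kernel itself is not monotone, since \<open>b\<^sub>m\<^sub>-\<^sub>k\<close> grows with \<open>k\<close>. After
  the rescaling \<open>y\<^sub>k = b\<^sub>m\<^sub>-\<^sub>k x\<^sub>k\<close> it turns into \<open>t\<^sub>k\<^sup>\<alpha> b\<^sub>k\<^sub>-\<^sub>j / b\<^sub>m\<^sub>-\<^sub>j\<close>, which decreases in \<open>k\<close>, increases
  in \<open>j\<close> and has nonpositive mixed differences; the quadratic form of such a kernel is a positive
  combination of squares. The required inequalities follow from the logarithmic convexity of \<open>b\<close> and from
  the monotonicity of \<open>(i + 1)\<^sup>\<alpha> b\<^sub>i\<close>.

  For Cahn--Hilliard, \<open>\<G> = \<Delta>\<close> would suggest working with \<open>\<Delta>\<^sup>-\<^sup>1 \<delta>\<^sup>k\<close>. No Poisson problem has to be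
  solved: inverting the triangular Toeplitz system of the L1 derivative yields combinations \<open>\<psi>\<^sup>k\<close> of
  the \<open>\<mu>\<^sup>j\<close> with \<open>\<delta>\<^sup>k = \<Delta>\<psi>\<^sup>k\<close>, and integration by parts reduces the sum to the same quadratic form in the
  partial derivatives of the \<open>\<psi>\<^sup>k\<close> (\<open>dissipation_mass_conserving_flow\<close>).
\<close>

section \<open>The quadratic form of the weighted L1 derivative\<close>

text \<open>Exchanging the sums gives \<open>\<Sum>\<^sub>j c\<^sub>j y\<^sub>j T\<^sub>j\<close> with the tail sums \<open>T\<^sub>j = y\<^sub>j + \<dots> + y\<^sub>m\<close>. Since
  \<open>y\<^sub>j T\<^sub>j \<ge> (T\<^sub>j\<^sup>2 - T\<^sub>j\<^sub>+\<^sub>1\<^sup>2) / 2\<close>, Abel summation against the increasing weights \<open>c\<close> leaves a nonnegative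
  quantity.\<close>

lemma min_kernel_nonneg:
  fixes c y :: "nat \<Rightarrow> real"
  assumes "0 \<le> c 1" and mono: "\<And>j. 1 \<le> j \<Longrightarrow> j < m \<Longrightarrow> c j \<le> c (Suc j)"
  shows "0 \<le> (\<Sum>k=1..m. \<Sum>j=1..k. c j * y k * y j)"
proof (cases "m = 0")
  case False
  have nonneg: "0 \<le> c j" if "1 \<le> j" "j \<le> m" for j
    using that
  proof (induction j rule: dec_induct)
    case base then show ?case using assms(1) by simp
  next
    case (step n) then show ?case using mono[of n] by simp
  qed
  define T where "T i = (\<Sum>k=i..m. y k)" for i
  have T_step: "T i = y i + T (Suc i)" if "i \<le> m" for i
    unfolding T_def using that by (simp add: sum.atLeast_Suc_atMost)
  \<comment> \<open>Downward induction from \<open>i = m\<close>; the case \<open>i = 1\<close> is the claim.\<close>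
  have tail: "c i * (T i)\<^sup>2 / 2 \<le> (\<Sum>j=i..m. c j * y j * T j)" if "1 \<le> i" "i \<le> m" for i
    using \<open>i \<le> m\<close> \<open>1 \<le> i\<close>
  proof (induction i rule: inc_induct)
    case base
    have "0 \<le> c m" using nonneg base by simp
    moreover have "T m = y m" by (simp add: T_def)
    ultimately show ?case by (simp add: power2_eq_square)
  next
    case (step i)
    have ci: "0 \<le> c i" using nonneg step by simp
    have le: "c i * (T (Suc i))\<^sup>2 \<le> c (Suc i) * (T (Suc i))\<^sup>2"
      using mono[of i] step by (intro mult_right_mono) auto
    have "c i * (T i)\<^sup>2 / 2 + c i * (y i)\<^sup>2 / 2 = c i * y i * T i + c i * (T (Suc i))\<^sup>2 / 2"
      using T_step[of i] step by (simp add: field_simps power2_eq_square)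
    moreover have "0 \<le> c i * (y i)\<^sup>2" using ci by simp
    moreover have "(\<Sum>j=i..m. c j * y j * T j) = c i * y i * T i + (\<Sum>j=Suc i..m. c j * y j * T j)"
      using step by (simp add: sum.atLeast_Suc_atMost)
    moreover have "c (Suc i) * (T (Suc i))\<^sup>2 / 2 \<le> (\<Sum>j=Suc i..m. c j * y j * T j)"
      using step by simp
    ultimately show ?case using le by linarith
  qed
  have "(\<Sum>k=1..m. \<Sum>j=1..k. c j * y k * y j) = (\<Sum>j=1..m. \<Sum>k=j..m. c j * y k * y j)"
  proof -
    have "(\<Sum>k=1..m. \<Sum>j\<in>{j \<in> {1..m}. j \<le> k}. c j * y k * y j)
        = (\<Sum>j=1..m. \<Sum>k\<in>{k \<in> {1..m}. j \<le> k}. c j * y k * y j)"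
      by (rule sum.swap_restrict) auto
    moreover have "{j \<in> {1..m}. j \<le> k} = {1..k}" if "k \<in> {1..m}" for k
      using that by auto
    moreover have "{k \<in> {1..m}. j \<le> k} = {j..m}" if "j \<in> {1..m}" for j
      using that by auto
    ultimately show ?thesis by simp
  qed
  also have "\<dots> = (\<Sum>j=1..m. c j * y j * T j)"
    by (simp add: T_def sum_distrib_left mult_ac)
  also have "\<dots> \<ge> 0"
    using tail[of 1] False assms(1) by (smt (verit) One_nat_def Suc_leI mult_nonneg_nonneg not_gr_zero zero_le_power2 divide_nonneg_nonneg le_refl)
  finally show ?thesis .
qed simp

text \<open>Induction on the size. Subtracting the last row from all rows splits off a kernel that depends on
  \<open>j\<close> only, covered by the preceding lemma; the remainder has one row less, and its last row is
  increasing again by the condition on mixed differences.\<close>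

lemma triangular_form_nonneg:
  fixes M :: "nat \<Rightarrow> nat \<Rightarrow> real" and y :: "nat \<Rightarrow> real"
  assumes "1 \<le> m \<Longrightarrow> 0 \<le> M m 1"
    and "\<And>j. 1 \<le> j \<Longrightarrow> j < m \<Longrightarrow> M m j \<le> M m (Suc j)"
    and "\<And>k. 1 \<le> k \<Longrightarrow> k < m \<Longrightarrow> M (Suc k) 1 \<le> M k 1"
    and "\<And>k j. 1 \<le> j \<Longrightarrow> j < k \<Longrightarrow> k < m \<Longrightarrow>
           M k j - M (Suc k) j \<le> M k (Suc j) - M (Suc k) (Suc j)"
  shows "0 \<le> (\<Sum>k=1..m. \<Sum>j=1..k. M k j * y k * y j)"
  using assms
proof (induction m arbitrary: M)
  case (Suc m)
  let ?N = "\<lambda>k j. M k j - M (Suc m) j"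
  have 1: "0 \<le> (\<Sum>k=1..m. \<Sum>j=1..k. ?N k j * y k * y j)"
  proof (rule Suc.IH)
    show "0 \<le> ?N m 1" if "1 \<le> m" using Suc.prems(3)[of m] that by simp
    show "?N m j \<le> ?N m (Suc j)" if "1 \<le> j" "j < m" for j
      using Suc.prems(4)[of j m] that by simp
    show "?N (Suc k) 1 \<le> ?N k 1" if "1 \<le> k" "k < m" for k
      using Suc.prems(3)[of k] that by simp
    show "?N k j - ?N (Suc k) j \<le> ?N k (Suc j) - ?N (Suc k) (Suc j)"
      if "1 \<le> j" "j < k" "k < m" for k j
      using Suc.prems(4)[of j k] that by simp
  qed
  have 2: "0 \<le> (\<Sum>k=1..Suc m. \<Sum>j=1..k. M (Suc m) j * y k * y j)"
    by (rule min_kernel_nonneg) (use Suc.prems in auto)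
  have "(\<Sum>k=1..Suc m. \<Sum>j=1..k. M k j * y k * y j)
      = (\<Sum>k=1..Suc m. \<Sum>j=1..k. ?N k j * y k * y j)
        + (\<Sum>k=1..Suc m. \<Sum>j=1..k. M (Suc m) j * y k * y j)"
    by (simp add: sum.distrib[symmetric] algebra_simps del: sum.cl_ivl_Suc)
  also have "(\<Sum>k=1..Suc m. \<Sum>j=1..k. ?N k j * y k * y j)
      = (\<Sum>k=1..m. \<Sum>j=1..k. ?N k j * y k * y j)"
    by simp
  finally show ?case using 1 2 by linarith
qed simp

text \<open>Up to a constant factor, the coefficient \<open>b\<^sub>i\<close> of the L1 derivative is this increment with exponent
  \<open>p = 1 - \<alpha>\<close>.\<close>

definition pow_incr :: "real \<Rightarrow> nat \<Rightarrow> real" where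
  "pow_incr p i = (real i + 1) powr p - real i powr p"

lemma pow_incr_pos: "0 < p \<Longrightarrow> 0 < pow_incr p i"
  by (simp add: pow_incr_def powr_less_mono2)

text \<open>The increments are integrals of the log-convex function \<open>p x\<^sup>p\<^sup>-\<^sup>1\<close>, and log-convexity survives
  integration because it says that the form \<open>l\<^sup>2 A + 2 l B + C\<close> is nonnegative for \<open>l \<le> 0\<close>, which is
  linear in the three values \<open>A\<close>, \<open>B\<close>, \<open>C\<close>. Nonnegativity of the integrand appears here as monotonicity
  of the antiderivative \<open>G\<close>; the form is used at its minimizer \<open>l = - B / A\<close>.\<close>

lemma pow_incr_log_convex:
  assumes p: "0 < p" "p < 1"
  shows "(pow_incr p (Suc i))\<^sup>2 \<le> pow_incr p i * pow_incr p (Suc (Suc i))"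
proof -
  define l where "l = - pow_incr p (Suc i) / pow_incr p i"
  define G where "G x = l\<^sup>2 * (x - 1) powr p + 2 * l * x powr p + (x + 1) powr p" for x :: real
  let ?n = "real i + 1"
  have "G ?n \<le> G (?n + 1)"
  proof (rule DERIV_nonneg_imp_increasing_open[where f = G])
    fix x :: real assume x: "?n < x" "x < ?n + 1"
    let ?u = "(x - 1) powr ((p - 1) / 2)" and ?v = "(x + 1) powr ((p - 1) / 2)"
    have der: "(G has_real_derivative
        p * (l\<^sup>2 * (x - 1) powr (p - 1) + 2 * l * x powr (p - 1) + (x + 1) powr (p - 1))) (at x)"
      unfolding G_def using x by (auto intro!: derivative_eq_intros simp: algebra_simps)
    have sq: "(x - 1) powr (p - 1) = ?u\<^sup>2" "(x + 1) powr (p - 1) = ?v\<^sup>2"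
      using x by (simp_all add: power2_eq_square powr_add[symmetric])
    have "x powr (p - 1) = (x\<^sup>2) powr ((p - 1) / 2)"
      using x by (simp add: powr_powr diff_divide_distrib flip: powr_numeral)
    also have "\<dots> \<le> ((x - 1) * (x + 1)) powr ((p - 1) / 2)"
    proof -
      have "(x - 1) * (x + 1) \<le> x\<^sup>2" by (simp add: algebra_simps power2_eq_square)
      then show ?thesis using p x by (intro powr_mono2') auto
    qed
    also have "\<dots> = ?u * ?v" using x by (simp add: powr_mult)
    finally have le: "x powr (p - 1) \<le> ?u * ?v" .
    have "l \<le> 0" unfolding l_def using p pow_incr_pos[of p] by (simp add: less_imp_le)
    then have "l * (?u * ?v) \<le> l * x powr (p - 1)" using le by (rule mult_left_mono_neg[rotated])
    moreover have "0 \<le> (l * ?u + ?v)\<^sup>2" by simp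
    ultimately have "0 \<le> l\<^sup>2 * ?u\<^sup>2 + 2 * l * x powr (p - 1) + ?v\<^sup>2"
      by (simp add: power2_eq_square algebra_simps)
    then show "\<exists>y. (G has_real_derivative y) (at x) \<and> 0 \<le> y"
      using der p unfolding sq by (metis mult_nonneg_nonneg less_imp_le)
  next
    show "continuous_on {?n..?n + 1} G"
      unfolding G_def using p by (intro continuous_intros continuous_on_powr') auto
  qed simp
  then have "0 \<le> l\<^sup>2 * pow_incr p i + 2 * l * pow_incr p (Suc i) + pow_incr p (Suc (Suc i))"
    by (simp add: G_def pow_incr_def algebra_simps)
  then have "0 \<le> pow_incr p i * (l\<^sup>2 * pow_incr p i + 2 * l * pow_incr p (Suc i) + pow_incr p (Suc (Suc i)))"
    using pow_incr_pos[of p i] p by simp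
  also have "\<dots> = pow_incr p i * pow_incr p (Suc (Suc i)) - (pow_incr p (Suc i))\<^sup>2"
    using pow_incr_pos[of p i] p by (simp add: l_def field_simps power2_eq_square)
  finally show ?thesis by simp
qed

lemma pow_incr_ratio_mono:
  assumes p: "0 < p" "p < 1" and "i \<le> q"
  shows "pow_incr p (Suc i) / pow_incr p i \<le> pow_incr p (Suc q) / pow_incr p q"
  using \<open>i \<le> q\<close>
proof (induction q rule: dec_induct)
  case (step n)
  have "pow_incr p (Suc n) / pow_incr p n \<le> pow_incr p (Suc (Suc n)) / pow_incr p (Suc n)"
    using pow_incr_log_convex[OF p, of n] pow_incr_pos[OF p(1), of n] pow_incr_pos[OF p(1), of "Suc n"]
    by (simp add: field_simps power2_eq_square)
  with step show ?case by linarith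
qed simp

text \<open>With \<open>n = i + 1\<close> this is \<open>1 + n\<^sup>\<alpha> (n - 1)\<^sup>1\<^sup>-\<^sup>\<alpha> \<le> (n + 1)\<^sup>\<alpha> n\<^sup>1\<^sup>-\<^sup>\<alpha>\<close>, the superadditivity of the weighted
  geometric mean. Dividing by the right-hand side and applying the weighted AM-GM inequality to both
  summands gives two bounds that add up to \<open>1\<close>.\<close>

lemma scaled_pow_incr_mono_first:
  assumes "0 < \<alpha>" "\<alpha> < 1"
  shows "(real i + 2) powr \<alpha> * pow_incr (1 - \<alpha>) (Suc i) \<le> (real i + 1) powr \<alpha> * pow_incr (1 - \<alpha>) i"
proof -
  let ?n = "real i + 1" and ?p = "1 - \<alpha>"
  have 1: "(1 / (?n + 1)) powr \<alpha> * (1 / ?n) powr ?p \<le> \<alpha> * (1 / (?n + 1)) + ?p * (1 / ?n)"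
    using assms by (intro Youngs_inequality_0) auto
  have 2: "(?n / (?n + 1)) powr \<alpha> * (real i / ?n) powr ?p \<le> \<alpha> * (?n / (?n + 1)) + ?p * (real i / ?n)"
    using assms Youngs_inequality_0[of \<alpha> ?p "?n / (?n + 1)" "real i / ?n"]
    by (cases "i = 0") auto
  have sum1: "\<alpha> * (1 / (?n + 1)) + ?p * (1 / ?n) + (\<alpha> * (?n / (?n + 1)) + ?p * (real i / ?n)) = 1"
  proof -
    have "1 / (?n + 1) + ?n / (?n + 1) = 1" "1 / ?n + real i / ?n = 1"
      by (simp_all add: add_divide_distrib[symmetric])
    then have "\<alpha> * (1 / (?n + 1) + ?n / (?n + 1)) + ?p * (1 / ?n + real i / ?n) = 1" by simp
    then show ?thesis by (simp only: distrib_left)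
  qed
  have "(1 / (?n + 1)) powr \<alpha> * (1 / ?n) powr ?p + (?n / (?n + 1)) powr \<alpha> * (real i / ?n) powr ?p \<le> 1"
    using 1 2 sum1 by linarith
  then have "1 + ?n powr \<alpha> * real i powr ?p \<le> (?n + 1) powr \<alpha> * ?n powr ?p"
    by (simp add: powr_divide field_simps)
  moreover have "?n powr \<alpha> * ?n powr ?p = ?n" "(?n + 1) powr \<alpha> * (?n + 1) powr ?p = ?n + 1"
    by (simp_all add: powr_add[symmetric])
  ultimately show ?thesis
    by (simp add: pow_incr_def algebra_simps)
qed

text \<open>The ratio \<open>(k + 1) / k\<close> is largest for the smallest admissible index \<open>k = i + 1\<close>, which is the
  preceding lemma.\<close>

lemma scaled_pow_incr_mono:
  assumes "0 < \<alpha>" "\<alpha> < 1" and "i < k"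
  shows "(real k + 1) powr \<alpha> * pow_incr (1 - \<alpha>) (Suc i) \<le> real k powr \<alpha> * pow_incr (1 - \<alpha>) i"
proof -
  let ?c = "pow_incr (1 - \<alpha>)"
  have c: "0 < ?c i" for i using assms pow_incr_pos by simp
  have "(real k + 1) / real k \<le> (real i + 2) / (real i + 1)"
    using assms by (simp add: field_simps)
  then have "((real k + 1) / real k) powr \<alpha> \<le> ((real i + 2) / (real i + 1)) powr \<alpha>"
    using assms by (intro powr_mono2) auto
  moreover have "((real i + 2) / (real i + 1)) powr \<alpha> \<le> ?c i / ?c (Suc i)"
    using scaled_pow_incr_mono_first[OF assms(1,2), of i] c[of "Suc i"]
    by (simp add: powr_divide field_simps)
  ultimately have "((real k + 1) / real k) powr \<alpha> \<le> ?c i / ?c (Suc i)" by linarith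
  then show ?thesis
    using c[of "Suc i"] assms by (simp add: powr_divide field_simps)
qed

lemma L1_coeff_eq: "L1_coeff \<alpha> dt i = dt powr (1 - \<alpha>) / Gamma (2 - \<alpha>) * pow_incr (1 - \<alpha>) i"
  by (simp add: L1_coeff_def pow_incr_def)

lemma L1_coeff_pos: "\<alpha> < 1 \<Longrightarrow> 0 < dt \<Longrightarrow> 0 < L1_coeff \<alpha> dt i"
  by (simp add: L1_coeff_eq pow_incr_pos Gamma_real_pos)

lemma L1_coeff_Suc_le:
  assumes "0 < \<alpha>" "\<alpha> < 1" "0 < dt"
  shows "L1_coeff \<alpha> dt (Suc i) \<le> L1_coeff \<alpha> dt i"
proof -
  let ?c = "pow_incr (1 - \<alpha>)"
  have "(real i + 1) powr \<alpha> * ?c (Suc i) \<le> (real i + 2) powr \<alpha> * ?c (Suc i)"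
    using assms pow_incr_pos[of "1 - \<alpha>" "Suc i"] by (intro mult_right_mono powr_mono2) auto
  also have "\<dots> \<le> (real i + 1) powr \<alpha> * ?c i"
    using assms(1,2) by (rule scaled_pow_incr_mono_first)
  finally have "?c (Suc i) \<le> ?c i"
    by (rule mult_left_le_imp_le) simp
  then show ?thesis
    using assms unfolding L1_coeff_eq by (intro mult_left_mono) (auto simp: Gamma_real_pos less_imp_le)
qed

text \<open>The rescaling \<open>y\<^sub>k = b\<^sub>m\<^sub>-\<^sub>k x\<^sub>k\<close> brings the kernel into the form required by
  \<open>triangular_form_nonneg\<close>. Its last row is constant, and its first column decreases by
  \<open>scaled_pow_incr_mono\<close>. The mixed difference condition is affine in the ratio \<open>r = b\<^sub>q\<^sub>+\<^sub>1 / b\<^sub>q\<close>, and by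
  log-convexity it suffices to check it at the smallest ratio that can occur.\<close>

lemma weighted_L1_form_nonneg:
  assumes \<alpha>: "0 < \<alpha>" "\<alpha> < 1" and dt: "0 < dt"
  shows "0 \<le> (\<Sum>k=1..m. \<Sum>j=1..k. (real k * dt) powr \<alpha> * L1_coeff \<alpha> dt (m - k)
                 * L1_coeff \<alpha> dt (k - j) * x k * x j)"
proof -
  let ?c = "pow_incr (1 - \<alpha>)"
  define C where "C = dt powr (1 - \<alpha>) / Gamma (2 - \<alpha>)"
  have b: "L1_coeff \<alpha> dt i = C * ?c i" for i
    by (simp add: L1_coeff_eq C_def)
  have p: "0 < 1 - \<alpha>" "1 - \<alpha> < 1" using \<alpha> by auto
  have c: "0 < ?c i" for i using p pow_incr_pos by simp
  define M where "M k j = real k powr \<alpha> * (?c (k - j) / ?c (m - j))" for k j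
  have "0 \<le> (\<Sum>k=1..m. \<Sum>j=1..k. M k j * (?c (m - k) * x k) * (?c (m - j) * x j))"
  proof (rule triangular_form_nonneg)
    show "0 \<le> M m 1" using c by (simp add: M_def)
    show "M m j \<le> M m (Suc j)" if "1 \<le> j" "j < m" for j
      using c[of "m - j"] c[of "m - Suc j"] by (simp add: M_def)
    show "M (Suc k) 1 \<le> M k 1" if "1 \<le> k" "k < m" for k
      using scaled_pow_incr_mono[OF \<alpha>, of "k - 1" k] that c[of "m - 1"]
      by (simp add: M_def divide_right_mono add_ac)
    show "M k j - M (Suc k) j \<le> M k (Suc j) - M (Suc k) (Suc j)"
      if jk: "1 \<le> j" "j < k" "k < m" for k j
    proof -
      define i q where "i = k - Suc j" and "q = m - Suc j"
      have eq: "k - j = Suc i" "Suc k - j = Suc (Suc i)" "k - Suc j = i" "Suc k - Suc j = Suc i"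
        "m - j = Suc q" "m - Suc j = q" and iq: "i < q" "i < k"
        using jk by (auto simp: i_def q_def)
      define A B where "A = real k powr \<alpha>" and "B = real (Suc k) powr \<alpha>"
      \<comment> \<open>\<open>d\<close> is the slope of the affine function of the ratio \<open>r\<close>; \<open>?s\<close> is its smallest value.\<close>
      have d: "0 \<le> A * ?c i - B * ?c (Suc i)"
        using scaled_pow_incr_mono[OF \<alpha> iq(2)] by (simp add: A_def B_def add_ac)
      let ?r = "?c (Suc q) / ?c q" and ?s = "?c (Suc (Suc i)) / ?c (Suc i)"
      have rs: "?s \<le> ?r" using pow_incr_ratio_mono[OF p, of "Suc i" q] iq by simp
      have s: "?c (Suc i) / ?c i \<le> ?s" using pow_incr_ratio_mono[OF p, of i "Suc i"] by simp
      have "A * ?c (Suc i) = A * ?c i * (?c (Suc i) / ?c i)" using c[of i] by simp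
      also have "\<dots> \<le> A * ?c i * ?s"
        using s c[of i] by (intro mult_left_mono) (auto simp: A_def)
      finally have "A * ?c (Suc i) - B * ?c (Suc (Suc i)) \<le> ?s * (A * ?c i - B * ?c (Suc i))"
        using c[of "Suc i"] by (simp add: algebra_simps)
      also have "\<dots> \<le> ?r * (A * ?c i - B * ?c (Suc i))"
        using rs d by (rule mult_right_mono)
      finally have "(A * ?c (Suc i) - B * ?c (Suc (Suc i))) / ?c (Suc q)
          \<le> (A * ?c i - B * ?c (Suc i)) / ?c q"
        using c[of q] c[of "Suc q"] by (simp add: field_simps)
      then show ?thesis
        unfolding M_def eq A_def B_def by (simp add: diff_divide_distrib)
    qed
  qed
  also have "(\<Sum>k=1..m. \<Sum>j=1..k. M k j * (?c (m - k) * x k) * (?c (m - j) * x j))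
      = (\<Sum>k=1..m. \<Sum>j=1..k. real k powr \<alpha> * ?c (m - k) * ?c (k - j) * x k * x j)"
    using c by (intro sum.cong refl) (simp add: M_def less_imp_neq[symmetric] mult_ac)
  finally have "0 \<le> dt powr \<alpha> * C\<^sup>2 * \<dots>" by simp
  also have "\<dots> = (\<Sum>k=1..m. \<Sum>j=1..k. (real k * dt) powr \<alpha> * L1_coeff \<alpha> dt (m - k)
                 * L1_coeff \<alpha> dt (k - j) * x k * x j)"
    unfolding sum_distrib_left using dt
    by (intro sum.cong refl) (simp add: b powr_mult power2_eq_square mult_ac)
  finally show ?thesis .
qed

section \<open>Partial derivatives, the Laplacian and periodicity\<close>

text \<open>All differential operators are expressed through these directional derivatives, for which product
  rule and integration by parts take their scalar form.\<close>

definition partial :: "'a::euclidean_space \<Rightarrow> ('a \<Rightarrow> real) \<Rightarrow> 'a \<Rightarrow> real" where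
  "partial e f x = frechet_derivative f (at x) e"

lemma has_derivative_imp_partial: "(f has_derivative f') (at x) \<Longrightarrow> partial e f x = f' e"
  by (simp add: partial_def frechet_derivative_at[symmetric])

lemma partial_on_line:
  fixes f :: "'a::euclidean_space \<Rightarrow> real"
  assumes "f differentiable (at (x + t *\<^sub>R e))"
  shows "((\<lambda>t. f (x + t *\<^sub>R e)) has_real_derivative partial e f (x + t *\<^sub>R e)) (at t within U)"
proof -
  let ?F = "frechet_derivative f (at (x + t *\<^sub>R e))"
  have F: "(f has_derivative ?F) (at (x + t *\<^sub>R e))"
    using assms frechet_derivative_works by blast
  have "((\<lambda>t. x + t *\<^sub>R e) has_derivative (\<lambda>h. h *\<^sub>R e)) (at t within U)"
    by (auto intro!: derivative_eq_intros)
  from diff_chain_within[OF this has_derivative_at_withinI[OF F]]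
  have "((\<lambda>t. f (x + t *\<^sub>R e)) has_derivative (\<lambda>h. ?F (h *\<^sub>R e))) (at t within U)"
    by (simp add: o_def)
  moreover have "?F (h *\<^sub>R e) = partial e f (x + t *\<^sub>R e) * h" for h
    using linear_frechet_derivative[OF assms] by (simp add: linear_scale partial_def)
  ultimately show ?thesis by (simp add: has_field_derivative_def)
qed

lemma partial_lincomb:
  assumes "f differentiable (at x)" "g differentiable (at x)"
  shows "partial e (\<lambda>x. c * f x + d * g x) x = c * partial e f x + d * partial e g x"
proof -
  have "((\<lambda>x. c * f x + d * g x) has_derivative
      (\<lambda>h. c * frechet_derivative f (at x) h + d * frechet_derivative g (at x) h)) (at x)"
    using assms[unfolded frechet_derivative_works]
    by (auto intro!: derivative_eq_intros)
  from has_derivative_imp_partial[OF this] show ?thesis by (simp add: partial_def)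
qed

lemma partial_sum:
  assumes "finite I" "\<And>i. i \<in> I \<Longrightarrow> f i differentiable (at x)"
  shows "partial e (\<lambda>x. \<Sum>i\<in>I. c i * f i x) x = (\<Sum>i\<in>I. c i * partial e (f i) x)"
proof -
  have "((\<lambda>x. \<Sum>i\<in>I. c i * f i x) has_derivative
      (\<lambda>h. \<Sum>i\<in>I. c i * frechet_derivative (f i) (at x) h)) (at x)"
    by (intro has_derivative_sum has_derivative_mult_right)
       (use assms frechet_derivative_works in blast)
  from has_derivative_imp_partial[OF this] show ?thesis by (simp add: partial_def)
qed

lemma partial_mult:
  assumes "f differentiable (at x)" "g differentiable (at x)"
  shows "partial e (\<lambda>x. f x * g x) x = f x * partial e g x + partial e f x * g x"
proof -
  have "((\<lambda>x. f x * g x) has_derivative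
      (\<lambda>h. f x * frechet_derivative g (at x) h + frechet_derivative f (at x) h * g x)) (at x)"
    using assms[unfolded frechet_derivative_works] by (rule has_derivative_mult)
  from has_derivative_imp_partial[OF this] show ?thesis by (simp add: partial_def)
qed

lemma Ck_Suc_partial:
  "Ck (Suc k) f \<longleftrightarrow> (\<forall>x. f differentiable (at x)) \<and> (\<forall>e\<in>Basis. Ck k (partial e f))"
proof -
  have "(\<lambda>x. frechet_derivative f (at x) e) = partial e f" for e
    by (simp add: partial_def fun_eq_iff)
  then show ?thesis by simp
qed

text \<open>From here on the successor case is unfolded through \<open>Ck_Suc_partial\<close>, so that derivatives appear
  as \<open>partial\<close>.\<close>

declare Ck.simps(2)[simp del]

lemma Ck_SucD: "Ck (Suc k) f \<Longrightarrow> Ck k f"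
proof (induction k arbitrary: f)
  case 0
  then show ?case
    by (simp add: Ck_Suc_partial continuous_on_eq_continuous_at differentiable_imp_continuous_within)
next
  case (Suc k)
  then show ?case unfolding Ck_Suc_partial[of "Suc k"] Ck_Suc_partial[of k] by auto
qed

lemma Ck_le: "Ck k f \<Longrightarrow> j \<le> k \<Longrightarrow> Ck j f"
  by (induction k) (auto simp: le_Suc_eq dest: Ck_SucD)

lemma Ck_imp_continuous: "Ck k f \<Longrightarrow> continuous_on U f"
  using Ck_le[of k f 0] continuous_on_subset by auto

lemma Ck_imp_differentiable: "Ck k f \<Longrightarrow> 0 < k \<Longrightarrow> f differentiable (at x)"
  by (cases k) (auto simp: Ck_Suc_partial)

lemma Ck_partial: "Ck (Suc k) f \<Longrightarrow> e \<in> Basis \<Longrightarrow> Ck k (partial e f)"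
  by (simp add: Ck_Suc_partial)

lemma Ck_lincomb: "Ck k f \<Longrightarrow> Ck k g \<Longrightarrow> Ck k (\<lambda>x. c * f x + d * g x)"
proof (induction k arbitrary: f g)
  case 0 then show ?case by (auto intro!: continuous_intros)
next
  case (Suc k)
  have d: "f differentiable (at x)" "g differentiable (at x)" for x
    using Suc.prems by (auto simp: Ck_Suc_partial)
  have "partial e (\<lambda>x. c * f x + d * g x) = (\<lambda>x. c * partial e f x + d * partial e g x)" for e
    using d by (simp add: partial_lincomb fun_eq_iff)
  with Suc d show ?case by (auto simp: Ck_Suc_partial)
qed

lemma Ck_zero: "Ck k (\<lambda>x. 0)"
proof (induction k)
  case (Suc k)
  have "partial e (\<lambda>x. 0) = (\<lambda>x. 0)" for e :: 'a by (simp add: partial_def fun_eq_iff)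
  with Suc show ?case by (simp add: Ck_Suc_partial)
qed simp

lemma Ck_sum: "finite I \<Longrightarrow> (\<And>i. i \<in> I \<Longrightarrow> Ck k (f i)) \<Longrightarrow> Ck k (\<lambda>x. \<Sum>i\<in>I. c i * f i x)"
proof (induction rule: finite_induct)
  case empty then show ?case by (simp add: Ck_zero)
next
  case (insert i I)
  then show ?case using Ck_lincomb[of k "f i" "\<lambda>x. \<Sum>i\<in>I. c i * f i x" "c i" 1] by simp
qed

lemma C1_mult:
  assumes f: "Ck (Suc 0) f" and g: "Ck (Suc 0) g"
  shows "Ck (Suc 0) (\<lambda>x. f x * g x)"
proof -
  have d: "f differentiable (at x)" "g differentiable (at x)" for x
    using assms by (auto simp: Ck_Suc_partial)
  have "partial e (\<lambda>x. f x * g x) = (\<lambda>x. f x * partial e g x + partial e f x * g x)" for e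
    using d by (simp add: partial_mult fun_eq_iff)
  then show ?thesis
    using d assms Ck_imp_continuous[OF f] Ck_imp_continuous[OF g]
    by (auto simp: Ck_Suc_partial intro!: continuous_intros)
qed

lemma C1_inverse:
  assumes f: "Ck (Suc 0) f" and nz: "\<And>x. f x \<noteq> 0"
  shows "Ck (Suc 0) (\<lambda>x. inverse (f x))"
proof -
  have d: "f differentiable (at x)" for x
    using assms by (auto simp: Ck_Suc_partial)
  have der: "((\<lambda>x. inverse (f x)) has_derivative
      (\<lambda>h. - (inverse (f x) * frechet_derivative f (at x) h * inverse (f x)))) (at x)" for x
    using nz d frechet_derivative_works by (intro Deriv.has_derivative_inverse) auto
  have "partial e (\<lambda>x. inverse (f x)) = (\<lambda>x. - (inverse (f x) * partial e f x * inverse (f x)))" for e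
    using has_derivative_imp_partial[OF der] by (simp add: partial_def fun_eq_iff)
  moreover have "(\<lambda>x. inverse (f x)) differentiable (at x)" for x
    using der differentiable_def by blast
  ultimately show ?thesis
    using assms Ck_imp_continuous[OF f]
    by (auto simp: Ck_Suc_partial intro!: continuous_intros)
qed

lemma gradient_eq: "gradient f x = (\<Sum>e\<in>Basis. partial e f x *\<^sub>R e)"
  by (simp add: gradient_def partial_def)

lemma gradient_inner: "e \<in> Basis \<Longrightarrow> gradient f x \<bullet> e = partial e f x"
  by (simp add: gradient_eq)

lemma gradient_dot: "gradient f x \<bullet> gradient g x = (\<Sum>e\<in>Basis. partial e f x * partial e g x)"
  by (subst euclidean_inner) (simp add: gradient_inner)

lemma norm_gradient_sq: "(norm (gradient f x))\<^sup>2 = (\<Sum>e\<in>Basis. partial e f x * partial e f x)"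
  by (simp add: gradient_dot power2_norm_eq_inner)

lemma divergence_eq:
  assumes "v differentiable (at x)"
  shows "divergence v x = (\<Sum>e\<in>Basis. partial e (\<lambda>y. v y \<bullet> e) x)"
proof -
  have "((\<lambda>y. v y \<bullet> e) has_derivative (\<lambda>h. frechet_derivative v (at x) h \<bullet> e)) (at x)" for e
    using assms[unfolded frechet_derivative_works] by (rule has_derivative_inner_left)
  from has_derivative_imp_partial[OF this] show ?thesis by (simp add: divergence_def)
qed

lemma differentiable_componentwise:
  assumes "\<And>e. e \<in> Basis \<Longrightarrow> w e differentiable (at x)"
  shows "(\<lambda>y. \<Sum>e\<in>Basis. w e y *\<^sub>R e) differentiable (at x)"
  using assms by (intro differentiable_sum differentiable_scaleR) auto

lemma divergence_componentwise:
  assumes "\<And>e. e \<in> Basis \<Longrightarrow> w e differentiable (at x)"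
  shows "divergence (\<lambda>y. \<Sum>e\<in>Basis. w e y *\<^sub>R e) x = (\<Sum>e\<in>Basis. partial e (w e) x)"
proof -
  have "(\<lambda>y. (\<Sum>e\<in>Basis. w e y *\<^sub>R e) \<bullet> i) = w i" if "i \<in> Basis" for i
    using that by simp
  then show ?thesis
    by (simp add: divergence_eq differentiable_componentwise assms)
qed

lemma laplacian_eq:
  assumes "Ck (Suc (Suc k)) f"
  shows "laplacian f = (\<lambda>x. \<Sum>e\<in>Basis. partial e (partial e f) x)"
proof
  fix x
  have "gradient f = (\<lambda>x. \<Sum>e\<in>Basis. partial e f x *\<^sub>R e)" by (simp add: gradient_eq fun_eq_iff)
  moreover have "partial e f differentiable (at x)" if "e \<in> Basis" for e
    using assms that by (auto simp: Ck_Suc_partial)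
  ultimately show "laplacian f x = (\<Sum>e\<in>Basis. partial e (partial e f) x)"
    by (simp add: laplacian_def divergence_componentwise)
qed

lemma Ck_laplacian: 
  assumes "Ck (Suc (Suc k)) f"
  shows "Ck k (laplacian f)"
  unfolding laplacian_eq[OF assms]
  using Ck_sum[of Basis k "\<lambda>e. partial e (partial e f)" "\<lambda>_. 1"] Ck_partial Ck_partial assms
  by fastforce

lemma laplacian_lincomb:
  assumes f: "Ck (Suc (Suc 0)) f" and g: "Ck (Suc (Suc 0)) g"
  shows "laplacian (\<lambda>x. c * f x + d * g x) x = c * laplacian f x + d * laplacian g x"
proof -
  have diff: "f differentiable (at x)" "g differentiable (at x)" for x
    using assms by (auto simp: Ck_Suc_partial)
  have "partial e (\<lambda>x. c * f x + d * g x) = (\<lambda>x. c * partial e f x + d * partial e g x)" for e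
    using diff by (simp add: partial_lincomb fun_eq_iff)
  moreover have "partial e f differentiable (at x)" "partial e g differentiable (at x)"
    if "e \<in> Basis" for e
    using assms that by (auto simp: Ck_Suc_partial)
  ultimately show ?thesis
    by (simp add: laplacian_eq[OF Ck_lincomb[OF f g]] laplacian_eq[OF f] laplacian_eq[OF g]
        partial_lincomb sum.distrib sum_distrib_left)
qed

lemma laplacian_zero: "laplacian (\<lambda>x. 0) x = 0"
proof -
  have "partial e (\<lambda>x. 0) = (\<lambda>x. 0)" for e :: 'a by (simp add: partial_def fun_eq_iff)
  then show ?thesis by (simp add: laplacian_eq[OF Ck_zero])
qed

lemma laplacian_sum:
  assumes "finite I" "\<And>i. i \<in> I \<Longrightarrow> Ck (Suc (Suc 0)) (f i)"
  shows "laplacian (\<lambda>x. \<Sum>i\<in>I. c i * f i x) x = (\<Sum>i\<in>I. c i * laplacian (f i) x)"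
  using assms
proof (induction rule: finite_induct)
  case empty then show ?case by (simp add: laplacian_zero)
next
  case (insert i I)
  then show ?case
    using laplacian_lincomb[of "f i" "\<lambda>x. \<Sum>i\<in>I. c i * f i x" "c i" 1 x]
      Ck_sum[of I "Suc (Suc 0)" f c] by simp
qed

text \<open>Second derivative test along each coordinate axis: a positive second derivative at \<open>x\<close> would make
  the first derivative positive to the right of \<open>x\<close>, and the function would exceed its maximum.\<close>

lemma laplacian_le_0_at_max:
  assumes f: "Ck (Suc (Suc 0)) f" and max: "\<And>y. f y \<le> f x"
  shows "laplacian f x \<le> 0"
  unfolding laplacian_eq[OF f]
proof (rule sum_nonpos, rule ccontr)
  fix e :: 'a
  assume e: "e \<in> Basis" and "\<not> partial e (partial e f) x \<le> 0"
  let ?g = "\<lambda>t. f (x + t *\<^sub>R e)" and ?g' = "\<lambda>t. partial e f (x + t *\<^sub>R e)"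
  have g: "(?g has_real_derivative ?g' t) (at t)" for t
    using f by (intro partial_on_line) (simp add: Ck_Suc_partial)
  have "(?g' has_real_derivative partial e (partial e f) (x + 0 *\<^sub>R e)) (at 0)"
    using f e by (intro partial_on_line) (simp add: Ck_Suc_partial)
  then have "\<exists>d>0. \<forall>h>0. 0 + h \<in> UNIV \<longrightarrow> h < d \<longrightarrow> ?g' 0 < ?g' (0 + h)"
    using \<open>\<not> _\<close> by (intro has_real_derivative_pos_inc_right) auto
  then obtain d where d: "d > 0" "\<And>h. 0 < h \<Longrightarrow> h < d \<Longrightarrow> ?g' 0 < ?g' h" by auto
  have "?g' 0 = 0"
    using g[of 0] max by (intro DERIV_local_max[of ?g _ 0 1]) auto
  have "?g 0 < ?g (d / 2)"
  proof (rule DERIV_pos_imp_increasing_open[where f = ?g])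
    show "\<exists>y. (?g has_real_derivative y) (at t) \<and> 0 < y" if "0 < t" "t < d / 2" for t
      using g[of t] d(2)[of t] that \<open>?g' 0 = 0\<close> by auto
    show "continuous_on {0..d / 2} ?g"
      using g by (intro DERIV_continuous_on) (auto intro: has_field_derivative_at_within)
  qed (use d in auto)
  with max[of "x + (d / 2) *\<^sub>R e"] show False by simp
qed

text \<open>The shifted function is the function itself, and the derivative commutes with translation.\<close>

lemma box_periodic_partial:
  assumes per: "box_periodic a b f" and diff: "\<And>x. f differentiable (at x)"
  shows "box_periodic a b (partial e f)"
  unfolding box_periodic_def
proof (intro ballI allI)
  fix i x :: 'a assume i: "i \<in> Basis"
  let ?c = "((b - a) \<bullet> i) *\<^sub>R i"
  have shift: "((\<lambda>y. y + ?c) has_derivative (\<lambda>h. h)) (at x)"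
    by (auto intro!: derivative_eq_intros)
  have "(f has_derivative frechet_derivative f (at (x + ?c))) (at (x + ?c))"
    using diff frechet_derivative_works by blast
  then have "((\<lambda>y. f (y + ?c)) has_derivative frechet_derivative f (at (x + ?c))) (at x)"
    using diff_chain_at[OF shift] by (simp add: o_def)
  moreover have "(\<lambda>y. f (y + ?c)) = f"
    using per i by (simp add: box_periodic_def fun_eq_iff)
  ultimately show "partial e f (x + ?c) = partial e f x"
    by (metis has_derivative_imp_partial partial_def)
qed

lemma box_periodic_lincomb:
  "box_periodic a b f \<Longrightarrow> box_periodic a b g \<Longrightarrow> box_periodic a b (\<lambda>x. c * f x + d * g x)"
  by (simp add: box_periodic_def)

lemma box_periodic_sum:
  "(\<And>i. i \<in> I \<Longrightarrow> box_periodic a b (f i)) \<Longrightarrow> box_periodic a b (\<lambda>x. \<Sum>i\<in>I. c i * f i x)"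
  by (simp add: box_periodic_def)

lemma box_periodic_laplacian:
  assumes "box_periodic a b f" and f: "Ck (Suc (Suc k)) f"
  shows "box_periodic a b (laplacian f)"
proof -
  have "box_periodic a b (partial e (partial e f))" if "e \<in> Basis" for e
    using assms that by (intro box_periodic_partial) (auto simp: Ck_Suc_partial)
  from box_periodic_sum[where c = "\<lambda>_. 1", OF this] show ?thesis
    unfolding laplacian_eq[OF f] by simp
qed

section \<open>Integration by parts on the periodic box\<close>

lemma integrable_of_continuous:
  fixes f :: "'a::euclidean_space \<Rightarrow> real"
  shows "continuous_on UNIV f \<Longrightarrow> f integrable_on cbox a b"
  by (rule integrable_continuous) (blast intro: continuous_on_subset)

text \<open>The shifted box and the original box share the part above \<open>a \<bullet> e + h\<close>; what sticks out at the
  upper end is a translate by one period of what is lost at the lower end.\<close>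

lemma integral_shift_box_periodic:
  fixes f :: "'a::euclidean_space \<Rightarrow> real"
  assumes per: "box_periodic a b f" and cont: "continuous_on UNIV f" and e: "e \<in> Basis"
    and h: "0 \<le> h" "h \<le> (b - a) \<bullet> e"
  shows "integral (cbox a b) (\<lambda>x. f (x + h *\<^sub>R e)) = integral (cbox a b) f"
proof -
  let ?l = "(b - a) \<bullet> e"
  have int: "f integrable_on cbox u v" for u v
    using cont by (rule integrable_of_continuous)
  have be: "i \<bullet> e = (if i = e then 1 else 0)" "e \<bullet> i = (if i = e then 1 else 0)" if "i \<in> Basis" for i
    using e that by (auto simp: inner_Basis)
  have "cbox (a + h *\<^sub>R e) (b + h *\<^sub>R e) \<inter> {x. x \<bullet> e \<le> b \<bullet> e} = cbox (a + h *\<^sub>R e) b"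
    using e h by (auto simp: mem_box inner_add_left inner_diff_left be split: if_splits; smt (verit))
  moreover have "cbox (a + h *\<^sub>R e) (b + h *\<^sub>R e) \<inter> {x. x \<bullet> e \<ge> b \<bullet> e}
      = cbox (a + ?l *\<^sub>R e) (b + h *\<^sub>R e)"
    using e h by (auto simp: mem_box inner_add_left inner_diff_left be split: if_splits; smt (verit))
  moreover have "cbox a b \<inter> {x. x \<bullet> e \<le> a \<bullet> e + h} = cbox a (b + (h - ?l) *\<^sub>R e)"
    using e h by (auto simp: mem_box inner_add_left inner_diff_left be split: if_splits; smt (verit))
  moreover have "cbox a b \<inter> {x. x \<bullet> e \<ge> a \<bullet> e + h} = cbox (a + h *\<^sub>R e) b"
    using e h by (auto simp: mem_box inner_add_left inner_diff_left be split: if_splits; smt (verit))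
  moreover have "integral (cbox (a + ?l *\<^sub>R e) (b + h *\<^sub>R e)) f = integral (cbox a (b + (h - ?l) *\<^sub>R e)) f"
  proof -
    have "(\<lambda>x. f (x + ?l *\<^sub>R e)) = f"
      using per e by (simp add: box_periodic_def fun_eq_iff)
    moreover have "a + ?l *\<^sub>R e - ?l *\<^sub>R e = a" "b + h *\<^sub>R e - ?l *\<^sub>R e = b + (h - ?l) *\<^sub>R e"
      by (simp_all add: algebra_simps)
    ultimately show ?thesis
      using integral_shift_cbox[of "a + ?l *\<^sub>R e" "?l *\<^sub>R e" "b + h *\<^sub>R e" f] by metis
  qed
  moreover have "integral (cbox a b) (\<lambda>x. f (x + h *\<^sub>R e)) = integral (cbox (a + h *\<^sub>R e) (b + h *\<^sub>R e)) f"
    using integral_shift_cbox[of "a + h *\<^sub>R e" "h *\<^sub>R e" "b + h *\<^sub>R e" f] by simp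
  ultimately show ?thesis
    using integral_split[OF int e, of "a + h *\<^sub>R e" "b + h *\<^sub>R e" "b \<bullet> e"]
      integral_split[OF int e, of a b "a \<bullet> e + h"] by simp
qed

text \<open>The integral of \<open>f (x + h e)\<close> does not depend on \<open>h\<close>, and differentiation under the integral sign
  at \<open>h = 0\<close> gives the integral of the partial derivative. This avoids iterated integrals over the
  faces of the box.\<close>

lemma integral_partial_eq_0:
  fixes f :: "'a::euclidean_space \<Rightarrow> real"
  assumes per: "box_periodic a b f" and f: "Ck (Suc 0) f" and e: "e \<in> Basis"
    and ab: "a \<bullet> e < b \<bullet> e"
  shows "integral (cbox a b) (partial e f) = 0"
proof -
  let ?U = "{0..(b - a) \<bullet> e}"
  have l: "0 < (b - a) \<bullet> e" using ab by (simp add: inner_diff_left)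
  have cp: "continuous_on UNIV (partial e f)" and cf: "continuous_on UNIV f"
    using f e Ck_partial[THEN Ck_imp_continuous] Ck_imp_continuous by blast+
  have "((\<lambda>h. integral (cbox a b) (\<lambda>x. f (x + h *\<^sub>R e))) has_field_derivative
      integral (cbox a b) (\<lambda>x. partial e f (x + 0 *\<^sub>R e))) (at 0 within ?U)"
  proof (rule leibniz_rule_field_derivative)
    show "((\<lambda>h. f (x + h *\<^sub>R e)) has_field_derivative partial e f (x + h *\<^sub>R e)) (at h within ?U)" for h x
      using f by (intro partial_on_line Ck_imp_differentiable) auto
    show "(\<lambda>x. f (x + h *\<^sub>R e)) integrable_on cbox a b" for h
      by (intro integrable_of_continuous continuous_on_compose2[OF cf]) (auto intro!: continuous_intros)
    show "continuous_on (?U \<times> cbox a b) (\<lambda>(h, x). partial e f (x + h *\<^sub>R e))"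
      unfolding split_def
      by (intro continuous_on_compose2[OF cp]) (auto intro!: continuous_intros)
  qed (use l in auto)
  moreover have "((\<lambda>h. integral (cbox a b) (\<lambda>x. f (x + h *\<^sub>R e))) has_field_derivative 0) (at 0 within ?U)"
  proof (rule has_field_derivative_transform_within[OF _ zero_less_one])
    show "((\<lambda>h. integral (cbox a b) f) has_field_derivative 0) (at 0 within ?U)" by simp
  qed (use l integral_shift_box_periodic[OF per cf e] in auto)
  moreover have "at (0::real) within ?U \<noteq> bot"
    using l by (simp add: at_within_Icc_at_right trivial_limit_at_right_real)
  ultimately show ?thesis
    using vector_derivative_unique_within by (fastforce simp: has_real_derivative_iff_has_vector_derivative)
qed

locale periodic_box =
  fixes a b :: "'a::euclidean_space"
  assumes nondegenerate: "e \<in> Basis \<Longrightarrow> a \<bullet> e < b \<bullet> e"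
begin

definition periodic :: "nat \<Rightarrow> ('a \<Rightarrow> real) \<Rightarrow> bool" where
  "periodic k f \<longleftrightarrow> box_periodic a b f \<and> Ck k f"

lemma integration_by_parts:
  assumes f: "periodic (Suc 0) f" and g: "periodic (Suc 0) g" and e: "e \<in> Basis"
  shows "l2_inner a b f (partial e g) = - l2_inner a b (partial e f) g"
proof -
  have cf: "continuous_on UNIV f" and cg: "continuous_on UNIV g"
    and cpf: "continuous_on UNIV (partial e f)" and cpg: "continuous_on UNIV (partial e g)"
    using f g e by (auto simp: periodic_def intro: Ck_imp_continuous Ck_partial)
  have "integral (cbox a b) (partial e (\<lambda>x. f x * g x)) = 0"
    using f g e nondegenerate
    by (intro integral_partial_eq_0 C1_mult) (auto simp: periodic_def box_periodic_def)
  moreover have "partial e (\<lambda>x. f x * g x) = (\<lambda>x. f x * partial e g x + partial e f x * g x)"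
    using f g by (auto simp: periodic_def fun_eq_iff intro!: partial_mult Ck_imp_differentiable)
  moreover have "integral (cbox a b) (\<lambda>x. f x * partial e g x + partial e f x * g x)
      = l2_inner a b f (partial e g) + l2_inner a b (partial e f) g"
    unfolding l2_inner_def
    by (intro integral_add integrable_of_continuous continuous_intros cf cg cpf cpg)
  ultimately show ?thesis by simp
qed

end

section \<open>Energy increments\<close>

lemma second_order_upper_bound:
  fixes g g' g'' :: "real \<Rightarrow> real"
  assumes "\<And>t. (g has_real_derivative g' t) (at t)" "\<And>t. (g' has_real_derivative g'' t) (at t)"
    and bound: "\<And>t. g'' t \<le> C"
  shows "g 1 - g 0 \<le> g' 0 + C / 2"
proof -
  let ?diff = "\<lambda>m::nat. if m = 0 then g else if m = 1 then g' else g''"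
  have "\<exists>t. 0 < t \<and> t < 1 \<and> g 1 = (\<Sum>m<2. ?diff m 0 / fact m * 1 ^ m) + ?diff 2 t / fact 2 * 1 ^ 2"
    using assms by (intro Maclaurin) auto
  then obtain t where "g 1 = g 0 + g' 0 + g'' t / 2"
    by (auto simp: numeral_2_eq_2)
  with bound[of t] show ?thesis by simp
qed

text \<open>The remainder of the first-order expansion is \<open>(r - s)\<^sup>2 ((r + s)\<^sup>2 + 2 s\<^sup>2 - 2) / 4\<close>, and the second
  factor is at most \<open>4\<close> on \<open>[-1, 1]\<close>.\<close>

lemma double_well_upper_bound:
  assumes "\<bar>s\<bar> \<le> 1" "\<bar>r\<bar> \<le> 1" "S \<ge> 2"
  shows "double_well r - double_well s \<le> (r - s) * (s ^ 3 - s + S * (r - s))"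
proof -
  have s2: "s\<^sup>2 \<le> 1" "r\<^sup>2 \<le> 1" using assms by (simp_all add: abs_square_le_1)
  have "2 * r * s \<le> r\<^sup>2 + s\<^sup>2" by (rule sum_squares_bound)
  then have le: "(r + s)\<^sup>2 + 2 * s\<^sup>2 \<le> 6" using s2 by (simp add: power2_sum)
  have "double_well r - double_well s
      = (r - s) * (s ^ 3 - s) + (r - s)\<^sup>2 * ((r + s)\<^sup>2 + 2 * s\<^sup>2 - 2) / 4"
    unfolding double_well_def by (simp add: power2_eq_square power3_eq_cube field_simps)
  also have "\<dots> \<le> (r - s) * (s ^ 3 - s) + (r - s)\<^sup>2 * S"
    using mult_left_mono[of "((r + s)\<^sup>2 + 2 * s\<^sup>2 - 2) / 4" S "(r - s)\<^sup>2"] le assms(3) by simp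
  finally show ?thesis by (simp add: algebra_simps power2_eq_square)
qed

text \<open>Taylor expansion along the segment from \<open>s\<close> to \<open>r\<close>, whose remainder is at most
  \<open>L (r - s)\<^sup>2 / 2\<close>.\<close>

lemma truncated_double_well_upper_bound:
  assumes F: "truncated_double_well F L" and "S \<ge> L / 2"
  shows "F r - F s \<le> (r - s) * (deriv F s + S * (r - s))"
proof -
  let ?u = "\<lambda>t. s + t * (r - s)"
  have F1: "(F has_real_derivative deriv F x) (at x)"
    and F2: "(deriv F has_real_derivative deriv (deriv F) x) (at x)"
    and F3: "deriv (deriv F) x \<le> L" for x
    using F unfolding truncated_double_well_def
    by (auto simp: field_differentiable_derivI abs_le_iff)
  have "F (?u 1) - F (?u 0) \<le> deriv F (?u 0) * (r - s) + (r - s)\<^sup>2 * L / 2"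
  proof (rule second_order_upper_bound[where g = "\<lambda>t. F (?u t)"])
    show "((\<lambda>t. F (?u t)) has_real_derivative deriv F (?u t) * (r - s)) (at t)" for t
      by (rule DERIV_chain2[OF F1]) (auto intro!: derivative_eq_intros)
    show "((\<lambda>t. deriv F (?u t) * (r - s)) has_real_derivative
        deriv (deriv F) (?u t) * (r - s) * (r - s)) (at t)" for t
      by (intro DERIV_cmult_right DERIV_chain2[OF F2]) (auto intro!: derivative_eq_intros)
    show "deriv (deriv F) (?u t) * (r - s) * (r - s) \<le> (r - s)\<^sup>2 * L" for t
      using mult_left_mono[OF F3, of "(r - s)\<^sup>2" "?u t"] by (simp add: power2_eq_square mult_ac)
  qed
  moreover have "(r - s)\<^sup>2 * (L / 2) \<le> (r - s)\<^sup>2 * S"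
    using assms(2) by (intro mult_left_mono) auto
  moreover have "(r - s) * (deriv F s + S * (r - s)) = deriv F s * (r - s) + (r - s)\<^sup>2 * S"
    by (simp add: algebra_simps power2_eq_square)
  ultimately show ?thesis by simp
qed

text \<open>Along the segment from \<open>p\<close> to \<open>q\<close> the second derivative of \<open>- ln (1 + \<bar>u\<bar>\<^sup>2) / 2\<close> is, by
  Cauchy--Schwarz, at most \<open>\<bar>q - p\<bar>\<^sup>2 (\<rho> - 1) / (1 + \<rho>)\<^sup>2\<close> with \<open>\<rho> = \<bar>u\<bar>\<^sup>2\<close>. The fraction has its
  maximum \<open>1/8\<close> at \<open>\<rho> = 3\<close>, and half of it is the threshold \<open>1/16\<close> for \<open>S\<close>.\<close>

lemma log_gradient_upper_bound:
  fixes p q :: "'a::real_inner"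
  assumes "S \<ge> 1 / 16"
  shows "- (1 / 2) * ln (1 + (norm q)\<^sup>2) - (- (1 / 2) * ln (1 + (norm p)\<^sup>2))
    \<le> - (p \<bullet> (q - p)) / (1 + (norm p)\<^sup>2) + S * (norm (q - p))\<^sup>2"
proof -
  define d where "d = q - p"
  let ?u = "\<lambda>t. p + t *\<^sub>R d"
  let ?n = "\<lambda>t. 1 + ?u t \<bullet> ?u t"
  have pos: "0 < ?n t" for t by (simp add: add_pos_nonneg)
  have n: "(?n has_real_derivative 2 * (?u t \<bullet> d)) (at t)" for t
    unfolding has_field_derivative_def
    by (auto intro!: derivative_eq_intros simp: inner_commute fun_eq_iff algebra_simps)
  have m: "((\<lambda>t. ?u t \<bullet> d) has_real_derivative d \<bullet> d) (at t)" for t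
    unfolding has_field_derivative_def
    by (auto intro!: derivative_eq_intros simp: fun_eq_iff)
  have "- (1 / 2) * ln (?n 1) - (- (1 / 2) * ln (?n 0)) \<le> - (?u 0 \<bullet> d) / ?n 0 + (d \<bullet> d) / 8 / 2"
  proof (rule second_order_upper_bound[where g = "\<lambda>t. - (1 / 2) * ln (?n t)"])
    show "((\<lambda>t. - (1 / 2) * ln (?n t)) has_real_derivative - (?u t \<bullet> d) / ?n t) (at t)" for t
      by (rule DERIV_cong[OF DERIV_cmult[OF DERIV_chain2[OF DERIV_ln_divide[OF pos] n]]])
        (simp add: field_simps)
    show "((\<lambda>t. - (?u t \<bullet> d) / ?n t) has_real_derivative
       (- (d \<bullet> d) * ?n t - - (?u t \<bullet> d) * (2 * (?u t \<bullet> d))) / (?n t * ?n t)) (at t)" for t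
      using pos[of t] by (intro DERIV_divide DERIV_minus n m) auto
    show "(- (d \<bullet> d) * ?n t - - (?u t \<bullet> d) * (2 * (?u t \<bullet> d))) / (?n t * ?n t) \<le> (d \<bullet> d) / 8" for t
    proof -
      let ?r = "?u t \<bullet> ?u t"
      have "(?u t \<bullet> d)\<^sup>2 \<le> ?r * (d \<bullet> d)" by (rule Cauchy_Schwarz_ineq)
      then have "- (d \<bullet> d) * ?n t - - (?u t \<bullet> d) * (2 * (?u t \<bullet> d)) \<le> (d \<bullet> d) * (?r - 1)"
        by (simp add: power2_eq_square algebra_simps)
      also have "\<dots> \<le> (d \<bullet> d) * (?n t * ?n t / 8)"
      proof (rule mult_left_mono)
        \<comment> \<open>Equality at \<open>?r = 3\<close>, the maximizer of \<open>(\<rho> - 1) / (1 + \<rho>)\<^sup>2\<close>.\<close>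
        have "0 \<le> (?r - 3)\<^sup>2" by simp
        then show "?r - 1 \<le> ?n t * ?n t / 8" by (simp add: power2_eq_square algebra_simps)
      qed simp
      finally show ?thesis using pos[of t] by (simp add: divide_le_eq)
    qed
  qed
  moreover have "d \<bullet> d / 16 \<le> S * (d \<bullet> d)" using mult_right_mono[OF assms, of "d \<bullet> d"] by simp
  ultimately show ?thesis
    by (simp add: d_def power2_norm_eq_inner)
qed

context periodic_box
begin

lemma periodic_imp_continuous: "periodic k f \<Longrightarrow> continuous_on U f"
  by (auto simp: periodic_def intro: Ck_imp_continuous)

lemma periodic_le: "periodic k f \<Longrightarrow> j \<le> k \<Longrightarrow> periodic j f"
  by (auto simp: periodic_def intro: Ck_le)

lemma periodic_partial: "periodic (Suc k) f \<Longrightarrow> e \<in> Basis \<Longrightarrow> periodic k (partial e f)"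
  by (auto simp: periodic_def Ck_partial intro!: box_periodic_partial Ck_imp_differentiable)

lemma periodic_laplacian: "periodic (Suc (Suc k)) f \<Longrightarrow> periodic k (laplacian f)"
  by (auto simp: periodic_def intro: Ck_laplacian box_periodic_laplacian)

lemma periodic_lincomb: "periodic k f \<Longrightarrow> periodic k g \<Longrightarrow> periodic k (\<lambda>x. c * f x + d * g x)"
  by (simp add: periodic_def Ck_lincomb box_periodic_lincomb)

lemma periodic_diff: "periodic k f \<Longrightarrow> periodic k g \<Longrightarrow> periodic k (\<lambda>x. f x - g x)"
  using periodic_lincomb[of k f g 1 "-1"] by simp

lemma periodic_sum:
  "finite I \<Longrightarrow> (\<And>i. i \<in> I \<Longrightarrow> periodic k (f i)) \<Longrightarrow> periodic k (\<lambda>x. \<Sum>i\<in>I. c i * f i x)"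
  by (simp add: periodic_def Ck_sum box_periodic_sum)

abbreviation ip (infixl "\<bullet>\<^sub>2" 70) where "f \<bullet>\<^sub>2 g \<equiv> l2_inner a b f g"

lemma ip_commute: "f \<bullet>\<^sub>2 g = g \<bullet>\<^sub>2 f"
  by (simp add: l2_inner_def mult.commute)

lemma ip_cmult_right: "f \<bullet>\<^sub>2 (\<lambda>x. c * g x) = c * (f \<bullet>\<^sub>2 g)"
  by (simp add: l2_inner_def mult.left_commute)

lemma ip_self_nonneg: "continuous_on UNIV f \<Longrightarrow> 0 \<le> f \<bullet>\<^sub>2 f"
  unfolding l2_inner_def
  by (intro integral_nonneg integrable_of_continuous continuous_intros) auto

lemma ip_sum_right:
  assumes "finite I" "continuous_on UNIV f" "\<And>i. i \<in> I \<Longrightarrow> continuous_on UNIV (g i)"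
  shows "f \<bullet>\<^sub>2 (\<lambda>x. \<Sum>i\<in>I. g i x) = (\<Sum>i\<in>I. f \<bullet>\<^sub>2 g i)"
  unfolding l2_inner_def sum_distrib_left
  by (intro integral_sum integrable_of_continuous continuous_intros assms)

lemma ip_add_right:
  assumes "continuous_on UNIV f" "continuous_on UNIV g" "continuous_on UNIV h"
  shows "f \<bullet>\<^sub>2 (\<lambda>x. g x + h x) = f \<bullet>\<^sub>2 g + f \<bullet>\<^sub>2 h"
  unfolding l2_inner_def distrib_left
  by (intro integral_add integrable_of_continuous continuous_intros assms)

lemma ip_diff_right:
  assumes "continuous_on UNIV f" "continuous_on UNIV g" "continuous_on UNIV h"
  shows "f \<bullet>\<^sub>2 (\<lambda>x. g x - h x) = f \<bullet>\<^sub>2 g - f \<bullet>\<^sub>2 h"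
  unfolding l2_inner_def right_diff_distrib
  by (intro integral_diff integrable_of_continuous continuous_intros assms)

lemma ip_diff_left:
  assumes "continuous_on UNIV f" "continuous_on UNIV g" "continuous_on UNIV h"
  shows "(\<lambda>x. g x - h x) \<bullet>\<^sub>2 f = g \<bullet>\<^sub>2 f - h \<bullet>\<^sub>2 f"
  using ip_diff_right[OF assms] by (simp add: ip_commute)

lemma ip_laplacian:
  assumes f: "periodic (Suc 0) f" and g: "periodic (Suc (Suc 0)) g"
  shows "f \<bullet>\<^sub>2 laplacian g = - (\<Sum>e\<in>Basis. partial e f \<bullet>\<^sub>2 partial e g)"
proof -
  have "f \<bullet>\<^sub>2 laplacian g = (\<Sum>e\<in>Basis. f \<bullet>\<^sub>2 partial e (partial e g))"
    unfolding laplacian_eq[OF conjunct2[OF g[unfolded periodic_def]]]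
    using f g by (intro ip_sum_right) (auto intro!: periodic_imp_continuous periodic_partial)
  also have "\<dots> = (\<Sum>e\<in>Basis. - (partial e f \<bullet>\<^sub>2 partial e g))"
    using f g by (intro sum.cong integration_by_parts periodic_partial) auto
  finally show ?thesis by (simp add: sum_negf)
qed

lemma laplacian_symmetric:
  assumes f: "periodic (Suc (Suc 0)) f" and g: "periodic (Suc (Suc 0)) g"
  shows "f \<bullet>\<^sub>2 laplacian g = laplacian f \<bullet>\<^sub>2 g"
  using ip_laplacian[of f g] ip_laplacian[of g f] periodic_le[OF f, of "Suc 0"] periodic_le[OF g, of "Suc 0"] f g
  by (simp add: ip_commute)

lemma op_L_symmetric:
  assumes "periodic (order_L M) f" "periodic (order_L M) g"
  shows "f \<bullet>\<^sub>2 op_L M \<epsilon> g = op_L M \<epsilon> f \<bullet>\<^sub>2 g"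
proof (cases M)
  case MBE
  have f: "periodic (Suc (Suc (Suc (Suc 0)))) f" and g: "periodic (Suc (Suc (Suc (Suc 0)))) g"
    using assms by (simp_all add: MBE numeral_eq_Suc)
  have f2: "periodic (Suc (Suc 0)) f" and g2: "periodic (Suc (Suc 0)) g"
    using f g by (auto elim: periodic_le)
  have "f \<bullet>\<^sub>2 laplacian (laplacian g) = laplacian (laplacian f) \<bullet>\<^sub>2 g"
    using laplacian_symmetric f2 g2 periodic_laplacian f g by presburger
  then show ?thesis
    using MBE ip_cmult_right ip_commute by simp
qed (use assms laplacian_symmetric[of f g] ip_cmult_right[of _ "- (\<epsilon>\<^sup>2)"] ip_commute in \<open>auto simp: numeral_eq_Suc\<close>)

lemma op_L_nonneg:
  assumes "periodic (order_L M) f"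
  shows "0 \<le> f \<bullet>\<^sub>2 op_L M \<epsilon> f"
proof -
  have neg: "f \<bullet>\<^sub>2 laplacian f \<le> 0" if f: "periodic (Suc (Suc 0)) f"
  proof -
    have "0 \<le> partial e f \<bullet>\<^sub>2 partial e f" if "e \<in> Basis" for e
      using f that by (intro ip_self_nonneg periodic_imp_continuous periodic_partial)
    then show ?thesis
      using ip_laplacian[of f f] f periodic_le[OF f, of "Suc 0"] by (simp add: sum_nonneg)
  qed
  show ?thesis
  proof (cases M)
    case MBE
    have f: "periodic (Suc (Suc (Suc (Suc 0)))) f"
      using assms by (simp_all add: MBE numeral_eq_Suc)
    have f2: "periodic (Suc (Suc 0)) f" and l: "periodic (Suc (Suc 0)) (laplacian f)"
      using f periodic_laplacian by (auto elim: periodic_le)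
    have "f \<bullet>\<^sub>2 laplacian (laplacian f) = laplacian f \<bullet>\<^sub>2 laplacian f"
      using f2 l by (rule laplacian_symmetric)
    also have "\<dots> \<ge> 0" using l by (intro ip_self_nonneg periodic_imp_continuous)
    finally show ?thesis
      using MBE ip_cmult_right by simp
  qed (use assms neg ip_cmult_right[of f "- (\<epsilon>\<^sup>2)"] in \<open>auto simp: numeral_eq_Suc mult_nonneg_nonpos\<close>)
qed

lemma op_L_diff:
  assumes "periodic (order_L M) f" "periodic (order_L M) g"
  shows "op_L M \<epsilon> (\<lambda>x. f x - g x) = (\<lambda>x. op_L M \<epsilon> f x - op_L M \<epsilon> g x)"
proof -
  have lap: "laplacian (\<lambda>x. f x - g x) = (\<lambda>x. laplacian f x - laplacian g x)"
    if "periodic (Suc (Suc 0)) f" "periodic (Suc (Suc 0)) g" for f g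
    using that laplacian_lincomb[of f g 1 "-1"] by (simp add: periodic_def fun_eq_iff)
  show ?thesis
  proof (cases M)
    case MBE
    have f: "periodic (Suc (Suc (Suc (Suc 0)))) f" and g: "periodic (Suc (Suc (Suc (Suc 0)))) g"
      using assms by (simp_all add: MBE numeral_eq_Suc)
    have f2: "periodic (Suc (Suc 0)) f" and g2: "periodic (Suc (Suc 0)) g"
      using f g by (auto elim: periodic_le)
    show ?thesis
      using MBE by (simp add: lap[OF f2 g2] lap[OF periodic_laplacian[OF f] periodic_laplacian[OF g]] algebra_simps)
  qed (use assms lap[of f g] in \<open>auto simp: numeral_eq_Suc algebra_simps\<close>)
qed

lemma op_L_continuous:
  assumes "periodic (order_L M) f"
  shows "continuous_on UNIV (op_L M \<epsilon> f)"
proof (cases M)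
  case MBE
  have "periodic (Suc (Suc (Suc (Suc 0)))) f"
    using assms by (simp_all add: MBE numeral_eq_Suc)
  then have "continuous_on UNIV (laplacian (laplacian f))"
    by (intro periodic_imp_continuous periodic_laplacian)
  then show ?thesis using MBE by (auto intro!: continuous_intros)
qed (use assms periodic_laplacian[of 0 f, THEN periodic_imp_continuous] in 
   \<open>auto simp: numeral_eq_Suc intro!: continuous_intros\<close>)

text \<open>For a symmetric operator the difference of both sides is \<open>\<langle>d, \<L> d\<rangle> / 2\<close> with \<open>d = g - f\<close>.\<close>

lemma quadratic_energy_le:
  assumes f: "periodic (order_L M) f" and g: "periodic (order_L M) g"
  shows "1 / 2 * (g \<bullet>\<^sub>2 op_L M \<epsilon> g) - 1 / 2 * (f \<bullet>\<^sub>2 op_L M \<epsilon> f)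
    \<le> (\<lambda>x. g x - f x) \<bullet>\<^sub>2 op_L M \<epsilon> g"
proof -
  note c = periodic_imp_continuous[OF f] periodic_imp_continuous[OF g]
    op_L_continuous[OF f] op_L_continuous[OF g]
  have "0 \<le> (\<lambda>x. g x - f x) \<bullet>\<^sub>2 op_L M \<epsilon> (\<lambda>x. g x - f x)"
    using f g by (intro op_L_nonneg periodic_diff)
  also have "\<dots> = (g \<bullet>\<^sub>2 op_L M \<epsilon> g - f \<bullet>\<^sub>2 op_L M \<epsilon> g) - (g \<bullet>\<^sub>2 op_L M \<epsilon> f - f \<bullet>\<^sub>2 op_L M \<epsilon> f)"
    unfolding op_L_diff[OF g f] using c by (simp add: ip_diff_right ip_diff_left continuous_on_diff)
  also have "g \<bullet>\<^sub>2 op_L M \<epsilon> f = f \<bullet>\<^sub>2 op_L M \<epsilon> g"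
    using op_L_symmetric[OF f g, of \<epsilon>] ip_commute by simp
  finally show ?thesis using c by (simp add: ip_diff_left)
qed

text \<open>These are the components of the vector field whose divergence is the variational derivative of the
  MBE energy.\<close>

definition slope_flux :: "'a \<Rightarrow> ('a \<Rightarrow> real) \<Rightarrow> 'a \<Rightarrow> real" where
  "slope_flux e f x = partial e f x * inverse (1 + (norm (gradient f x))\<^sup>2)"

lemma periodic_slope_flux:
  assumes f: "periodic (Suc (Suc 0)) f" and e: "e \<in> Basis"
  shows "periodic (Suc 0) (slope_flux e f)"
proof -
  have p: "periodic (Suc 0) (partial i f)" if "i \<in> Basis" for i
    using f that by (rule periodic_partial)
  have 1: "Ck (Suc 0) (\<lambda>x. \<Sum>i\<in>Basis. 1 * (partial i f x * partial i f x))"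
    using p by (intro Ck_sum C1_mult) (auto simp: periodic_def)
  have one: "Ck (Suc 0) (\<lambda>x::'a. 1::real)"
    by (simp add: Ck_Suc_partial partial_def)
  have 2: "Ck (Suc 0) (\<lambda>x. 1 + (norm (gradient f x))\<^sup>2)"
    using Ck_lincomb[OF one 1, of 1 1] by (simp add: norm_gradient_sq)
  have nz: "1 + (norm (gradient f x))\<^sup>2 \<noteq> 0" for x
    by (metis add_pos_nonneg less_irrefl zero_less_one zero_le_power2)
  have "Ck (Suc 0) (slope_flux e f)"
    unfolding slope_flux_def using p[OF e] nz 2
    by (intro C1_mult C1_inverse) (auto simp: periodic_def)
  moreover have "box_periodic a b (slope_flux e f)"
    using p e unfolding slope_flux_def norm_gradient_sq by (simp add: periodic_def box_periodic_def)
  ultimately show ?thesis by (simp add: periodic_def)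
qed

lemma var_deriv_MBE:
  assumes f: "periodic (Suc (Suc 0)) f"
  shows "var_deriv_1 MBE f = (\<lambda>x. \<Sum>e\<in>Basis. partial e (slope_flux e f) x)"
proof
  fix x
  have "gradient f y /\<^sub>R (1 + (norm (gradient f y))\<^sup>2) = (\<Sum>e\<in>Basis. slope_flux e f y *\<^sub>R e)" for y
    by (subst (1) gradient_eq) (simp add: slope_flux_def scaleR_sum_right mult.commute)
  moreover have "slope_flux e f differentiable (at x)" if "e \<in> Basis" for e
    using periodic_slope_flux[OF f that] by (auto simp: periodic_def Ck_Suc_partial)
  ultimately show "var_deriv_1 MBE f x = (\<Sum>e\<in>Basis. partial e (slope_flux e f) x)"
    by (simp add: divergence_componentwise)
qed

lemma var_deriv_1_continuous:
  assumes "admissible M S" and f: "periodic (order_L M) f"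
  shows "continuous_on UNIV (var_deriv_1 M f)"
proof (cases M)
  case Allen_Cahn
  then show ?thesis using periodic_imp_continuous[OF f] by (auto intro!: continuous_intros)
next
  case (Cahn_Hilliard F L)
  then have "continuous_on UNIV (deriv F)"
    using assms(1) by (auto simp: truncated_double_well_def continuous_on_eq_continuous_at
        intro: field_differentiable_imp_continuous_at)
  then show ?thesis
    using Cahn_Hilliard periodic_imp_continuous[OF f] by (auto intro: continuous_on_compose2)
next
  case MBE
  then have "periodic (Suc (Suc 0)) f" using f periodic_le by (simp add: numeral_eq_Suc)
  then show ?thesis
    unfolding MBE var_deriv_MBE[OF \<open>periodic (Suc (Suc 0)) f\<close>]
    by (intro continuous_on_sum periodic_imp_continuous[of 0] periodic_partial periodic_slope_flux)
qed

lemma op_stab_continuous: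
  assumes "periodic (order_L M) f"
  shows "continuous_on UNIV (op_stab M S f)"
proof (cases M)
  case MBE
  then have "periodic 2 (laplacian f)" using assms periodic_laplacian[of 2 f] by (simp add: numeral_eq_Suc)
  then show ?thesis using MBE periodic_imp_continuous by (auto intro!: continuous_intros)
qed (use periodic_imp_continuous[OF assms] in \<open>auto intro!: continuous_intros\<close>)

lemma integral_mono_continuous:
  fixes f g :: "'a \<Rightarrow> real"
  assumes "continuous_on UNIV f" "continuous_on UNIV g" "\<And>x. f x \<le> g x"
  shows "integral (cbox a b) f \<le> integral (cbox a b) g"
  using assms by (intro integral_le integrable_of_continuous) auto

lemma integral_diff_le_ip:
  assumes u: "continuous_on UNIV u" and v: "continuous_on UNIV v"
    and d: "continuous_on UNIV d" and w: "continuous_on UNIV w"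
    and le: "\<And>x. u x - v x \<le> d x * w x"
  shows "integral (cbox a b) u - integral (cbox a b) v \<le> d \<bullet>\<^sub>2 w"
proof -
  have "integral (cbox a b) u - integral (cbox a b) v = integral (cbox a b) (\<lambda>x. u x - v x)"
    using u v by (simp add: integral_diff integrable_of_continuous)
  also have "\<dots> \<le> d \<bullet>\<^sub>2 w"
    unfolding l2_inner_def using u v d w le
    by (intro integral_mono_continuous continuous_intros) auto
  finally show ?thesis .
qed

text \<open>Integration by parts moves both divergences onto \<open>d\<close>, so that the inner product on the right becomes
  the integral of the right-hand side of \<open>log_gradient_upper_bound\<close> with \<open>q - p = \<nabla>d\<close>.\<close>

lemma nonlinear_energy_le_MBE:
  assumes S: "S \<ge> 1 / 16" and f: "periodic (Suc (Suc 0)) f" and g: "periodic (Suc (Suc 0)) g"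
  defines "d \<equiv> \<lambda>x. g x - f x"
  shows "energy_1 a b MBE g - energy_1 a b MBE f
    \<le> d \<bullet>\<^sub>2 (\<lambda>x. var_deriv_1 MBE f x + op_stab MBE S d x)"
proof -
  have d: "periodic (Suc (Suc 0)) d" unfolding d_def using f g by (intro periodic_diff)
  have d1: "periodic (Suc 0) d" using d by (rule periodic_le) simp
  have pc: "continuous_on UNIV (partial e h)" if "periodic (Suc (Suc 0)) h" "e \<in> Basis" for e h
    using periodic_partial[OF that] by (rule periodic_imp_continuous)
  have fl: "continuous_on UNIV (slope_flux e f)" if "e \<in> Basis" for e
    using periodic_slope_flux[OF f that] by (rule periodic_imp_continuous)
  have gc: "continuous_on UNIV (\<lambda>x. ln (1 + (norm (gradient h x))\<^sup>2))" if "periodic (Suc (Suc 0)) h" for h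
    unfolding norm_gradient_sq
    by (intro continuous_on_ln continuous_intros pc that) (auto simp: add_nonneg_eq_0_iff sum_nonneg)
  have pd: "partial e d x = partial e g x - partial e f x" for e x
    using f g partial_lincomb[of g x f e 1 "-1"]
    by (simp add: d_def periodic_def Ck_Suc_partial)
  have gd: "gradient d x = gradient g x - gradient f x" for x
    by (simp add: gradient_eq pd scaleR_diff_left sum_subtractf)
  let ?r = "\<lambda>x. \<Sum>e\<in>Basis. - (partial e d x * slope_flux e f x) + S * (partial e d x * partial e d x)"
  have rc: "continuous_on UNIV ?r"
    by (intro continuous_intros pc fl d)
  have pw: "- (1 / 2) * ln (1 + (norm (gradient g x))\<^sup>2) - (- (1 / 2) * ln (1 + (norm (gradient f x))\<^sup>2)) \<le> ?r x" for x
  proof -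
    have "?r x = - (gradient f x \<bullet> gradient d x) / (1 + (norm (gradient f x))\<^sup>2) + S * (norm (gradient d x))\<^sup>2"
      by (simp add: sum.distrib sum_negf gradient_dot norm_gradient_sq[of d] slope_flux_def sum_distrib_left
          sum_distrib_right sum_subtractf divide_inverse mult_ac)
    then show ?thesis using log_gradient_upper_bound[OF S, of "gradient g x" "gradient f x"] by (simp add: gd)
  qed
  have "energy_1 a b MBE g - energy_1 a b MBE f
      = integral (cbox a b) (\<lambda>x. - (1 / 2) * ln (1 + (norm (gradient g x))\<^sup>2)
            - (- (1 / 2) * ln (1 + (norm (gradient f x))\<^sup>2)))"
    using gc[OF f] gc[OF g]
    by (subst integral_diff) (auto intro!: integrable_of_continuous continuous_intros)
  also have "\<dots> \<le> integral (cbox a b) ?r"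
    by (intro integral_mono_continuous continuous_intros gc f g rc pw)
  also have "\<dots> = (\<Sum>e\<in>Basis. - (partial e d \<bullet>\<^sub>2 slope_flux e f) + S * (partial e d \<bullet>\<^sub>2 partial e d))"
  proof -
    have "integral (cbox a b) (\<lambda>x. - (partial e d x * slope_flux e f x) + S * (partial e d x * partial e d x))
        = - (partial e d \<bullet>\<^sub>2 slope_flux e f) + S * (partial e d \<bullet>\<^sub>2 partial e d)" if "e \<in> Basis" for e
      unfolding l2_inner_def using pc[OF d that] fl[OF that]
      by (subst integral_add) (auto intro!: integrable_of_continuous continuous_intros)
    moreover have "integral (cbox a b) ?r = (\<Sum>e\<in>Basis. integral (cbox a b)
        (\<lambda>x. - (partial e d x * slope_flux e f x) + S * (partial e d x * partial e d x)))"
      by (intro integral_sum integrable_of_continuous continuous_intros pc d fl) auto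
    ultimately show ?thesis by simp
  qed
  also have "\<dots> = d \<bullet>\<^sub>2 (\<lambda>x. \<Sum>e\<in>Basis. partial e (slope_flux e f) x) + d \<bullet>\<^sub>2 (\<lambda>x. - S * laplacian d x)"
  proof -
    have "d \<bullet>\<^sub>2 (\<lambda>x. \<Sum>e\<in>Basis. partial e (slope_flux e f) x) = (\<Sum>e\<in>Basis. d \<bullet>\<^sub>2 partial e (slope_flux e f))"
      using f d by (intro ip_sum_right) (auto intro!: periodic_imp_continuous periodic_partial periodic_slope_flux)
    also have "\<dots> = (\<Sum>e\<in>Basis. - (partial e d \<bullet>\<^sub>2 slope_flux e f))"
      using f d1 by (intro sum.cong refl integration_by_parts periodic_slope_flux)
    finally have 1: "d \<bullet>\<^sub>2 (\<lambda>x. \<Sum>e\<in>Basis. partial e (slope_flux e f) x)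
        = (\<Sum>e\<in>Basis. - (partial e d \<bullet>\<^sub>2 slope_flux e f))" .
    have 2: "d \<bullet>\<^sub>2 (\<lambda>x. - S * laplacian d x) = S * (\<Sum>e\<in>Basis. partial e d \<bullet>\<^sub>2 partial e d)"
      using ip_cmult_right[of d "- S" "laplacian d"] ip_laplacian[OF d1 d] by simp
    show ?thesis unfolding 1 2 by (simp add: sum.distrib sum_distrib_left sum_negf sum_subtractf)
  qed
  also have "\<dots> = d \<bullet>\<^sub>2 (\<lambda>x. (\<Sum>e\<in>Basis. partial e (slope_flux e f) x) + - S * laplacian d x)"
    by (intro ip_add_right[symmetric] continuous_on_sum continuous_on_mult continuous_on_const
        periodic_imp_continuous[OF d] periodic_imp_continuous[OF periodic_laplacian[OF d]]
        periodic_imp_continuous[OF periodic_partial[OF periodic_slope_flux[OF f]]])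
  finally show ?thesis unfolding var_deriv_MBE[OF f] by simp
qed

lemma nonlinear_energy_le:
  fixes f g :: "'a \<Rightarrow> real"
  assumes adm: "admissible M S" and f: "periodic (order_L M) f" and g: "periodic (order_L M) g"
    and bound: "\<And>x. M = Allen_Cahn \<Longrightarrow> \<bar>f x\<bar> \<le> 1 \<and> \<bar>g x\<bar> \<le> 1"
  defines "d \<equiv> \<lambda>x. g x - f x"
  shows "energy_1 a b M g - energy_1 a b M f
    \<le> d \<bullet>\<^sub>2 (\<lambda>x. var_deriv_1 M f x + op_stab M S d x)"
proof (cases M)
  case MBE
  then have "periodic (Suc (Suc 0)) f" "periodic (Suc (Suc 0)) g"
    using f g periodic_le by (simp_all add: numeral_eq_Suc)
  with MBE adm show ?thesis unfolding d_def using nonlinear_energy_le_MBE by simp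
next
  case Allen_Cahn
  have c: "continuous_on UNIV f" "continuous_on UNIV g"
    using f g by (auto intro: periodic_imp_continuous)
  have "double_well (g x) - double_well (f x) \<le> d x * (f x ^ 3 - f x + S * d x)" for x
    unfolding d_def using adm bound Allen_Cahn by (intro double_well_upper_bound) auto
  moreover have "continuous_on UNIV (\<lambda>x. double_well (h x))" if "continuous_on UNIV h" for h :: "'a \<Rightarrow> real"
    unfolding double_well_def using that by (intro continuous_intros) auto
  ultimately show ?thesis
    using c unfolding Allen_Cahn
    by (auto simp: d_def intro!: integral_diff_le_ip continuous_intros)
next
  case (Cahn_Hilliard F L)
  have c: "continuous_on UNIV f" "continuous_on UNIV g"
    using f g by (auto intro: periodic_imp_continuous)
  have F: "truncated_double_well F L" and "S \<ge> L / 2" using adm Cahn_Hilliard by auto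
  then have Fc: "continuous_on UNIV F" "continuous_on UNIV (deriv F)"
    by (auto simp: truncated_double_well_def continuous_on_eq_continuous_at
        intro: field_differentiable_imp_continuous_at)
  have "F (g x) - F (f x) \<le> d x * (deriv F (f x) + S * d x)" for x
    unfolding d_def using F \<open>S \<ge> L / 2\<close> by (rule truncated_double_well_upper_bound)
  then show ?thesis
    using c Fc unfolding Cahn_Hilliard
    by (auto simp: d_def intro!: integral_diff_le_ip continuous_intros intro: continuous_on_compose2)
qed

text \<open>The step is a discrete chain rule with the right sign. The uniform bound by \<open>1\<close> for Allen--Cahn keeps
  both iterates in the range where the stabilization dominates the curvature of the double well.\<close>

lemma energy_le:
  assumes adm: "admissible M S" and f: "periodic (order_L M) (\<phi> n)" and g: "periodic (order_L M) (\<phi> (Suc n))"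
    and bound: "\<And>x. M = Allen_Cahn \<Longrightarrow> \<bar>\<phi> n x\<bar> \<le> 1 \<and> \<bar>\<phi> (Suc n) x\<bar> \<le> 1"
  shows "energy a b M \<epsilon> (\<phi> (Suc n)) - energy a b M \<epsilon> (\<phi> n)
    \<le> (\<lambda>x. \<phi> (Suc n) x - \<phi> n x) \<bullet>\<^sub>2 chem_potential M \<epsilon> S \<phi> n"
proof -
  let ?d = "\<lambda>x. \<phi> (Suc n) x - \<phi> n x"
  have d: "periodic (order_L M) ?d" using g f by (rule periodic_diff)
  have "chem_potential M \<epsilon> S \<phi> n = (\<lambda>x. op_L M \<epsilon> (\<phi> (Suc n)) x + (var_deriv_1 M (\<phi> n) x + op_stab M S ?d x))"
    by (simp add: chem_potential_def add.assoc)
  moreover have "?d \<bullet>\<^sub>2 (\<lambda>x. op_L M \<epsilon> (\<phi> (Suc n)) x + (var_deriv_1 M (\<phi> n) x + op_stab M S ?d x))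
      = ?d \<bullet>\<^sub>2 op_L M \<epsilon> (\<phi> (Suc n)) + ?d \<bullet>\<^sub>2 (\<lambda>x. var_deriv_1 M (\<phi> n) x + op_stab M S ?d x)"
    using var_deriv_1_continuous[OF adm f] op_stab_continuous[OF d] op_L_continuous[OF g] periodic_imp_continuous[OF d]
    by (intro ip_add_right continuous_on_add)
  moreover have "energy_1 a b M (\<phi> (Suc n)) - energy_1 a b M (\<phi> n)
    \<le> ?d \<bullet>\<^sub>2 (\<lambda>x. var_deriv_1 M (\<phi> n) x + op_stab M S ?d x)"
    using adm f g bound by (rule nonlinear_energy_le)
  ultimately show ?thesis
    using quadratic_energy_le[OF f g, of \<epsilon>] by (simp add: energy_def)
qed

end

section \<open>Maximum principle and inversion of the L1 derivative\<close>

text \<open>The L1 derivative at step \<open>n + 1\<close> is a multiple of \<open>v\<^sup>n\<^sup>+\<^sup>1\<close> minus a combination of the earlier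
  values. By summation by parts its weights are the decrements of \<open>b\<close> and the last coefficient, which
  are nonnegative and sum to \<open>b\<^sub>0\<close>.\<close>

lemma L1_history_bounded:
  assumes \<alpha>: "0 < \<alpha>" "\<alpha> < 1" and dt: "0 < dt" and v: "\<And>k. k \<le> n \<Longrightarrow> \<bar>v k\<bar> \<le> 1"
  shows "\<bar>L1_coeff \<alpha> dt 0 / dt * v (Suc n) - L1_caputo \<alpha> dt v (Suc n)\<bar> \<le> L1_coeff \<alpha> dt 0 / dt"
proof -
  define \<beta> where "\<beta> j = L1_coeff \<alpha> dt (Suc n - j)" for j
  have mono: "\<beta> j \<le> \<beta> (Suc j)" if "j \<le> n" for j
    using L1_coeff_Suc_le[OF \<alpha> dt, of "n - j"] that by (simp add: \<beta>_def Suc_diff_le)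
  have pos: "0 < \<beta> j" for j using L1_coeff_pos \<alpha> dt by (simp add: \<beta>_def)
  have "\<bar>\<beta> (Suc m) * v (Suc m) - (\<Sum>j=1..Suc m. \<beta> j * (v j - v (j - 1)))\<bar> \<le> \<beta> (Suc m)" if "m \<le> n" for m
    using that
  proof (induction m)
    case 0
    have "\<bar>\<beta> 1 * v 0\<bar> \<le> \<beta> 1 * 1"
      unfolding abs_mult using v[of 0] pos[of 1] by (intro mult_mono) auto
    then show ?case by (simp add: algebra_simps)
  next
    case (Suc m)
    let ?s = "\<Sum>j=1..Suc m. \<beta> j * (v j - v (j - 1))"
    have split: "\<beta> (Suc (Suc m)) * v (Suc (Suc m)) - (\<Sum>j=1..Suc (Suc m). \<beta> j * (v j - v (j - 1)))
        = (\<beta> (Suc (Suc m)) - \<beta> (Suc m)) * v (Suc m) + (\<beta> (Suc m) * v (Suc m) - ?s)"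
      by (simp add: algebra_simps)
    have "\<bar>(\<beta> (Suc (Suc m)) - \<beta> (Suc m)) * v (Suc m)\<bar> \<le> (\<beta> (Suc (Suc m)) - \<beta> (Suc m)) * 1"
      unfolding abs_mult using v[of "Suc m"] mono[of "Suc m"] Suc.prems by (intro mult_mono) auto
    moreover have "\<bar>\<beta> (Suc m) * v (Suc m) - ?s\<bar> \<le> \<beta> (Suc m)"
      using Suc by simp
    ultimately have "\<bar>(\<beta> (Suc (Suc m)) - \<beta> (Suc m)) * v (Suc m)\<bar>
        + \<bar>\<beta> (Suc m) * v (Suc m) - ?s\<bar> \<le> \<beta> (Suc (Suc m))" by simp
    then show ?case unfolding split by (rule order_trans[OF abs_triangle_ineq])
  qed
  from this[of n] have "\<bar>(L1_coeff \<alpha> dt 0 * v (Suc n) - (\<Sum>j=1..Suc n. \<beta> j * (v j - v (j - 1)))) / dt\<bar>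
      \<le> L1_coeff \<alpha> dt 0 / dt"
    using dt by (simp add: divide_right_mono \<beta>_def del: sum.cl_ivl_Suc)
  moreover have "L1_caputo \<alpha> dt v (Suc n) = (\<Sum>j=1..Suc n. \<beta> j * (v j - v (j - 1))) / dt"
    by (simp add: L1_caputo_def bdiff_def \<beta>_def sum_divide_distrib del: sum.cl_ivl_Suc)
  ultimately show ?thesis by (simp add: diff_divide_distrib)
qed

text \<open>Forward substitution for the lower triangular Toeplitz system with symbol \<open>\<beta>\<close>. The solution is built
  from \<open>u\<close> by linear combinations only, hence inherits periodicity and smoothness.\<close>

fun toeplitz_solution :: "(nat \<Rightarrow> real) \<Rightarrow> (nat \<Rightarrow> 'a \<Rightarrow> real) \<Rightarrow> nat \<Rightarrow> 'a \<Rightarrow> real" where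
  "toeplitz_solution \<beta> u k =
     (\<lambda>x. (u k x - (\<Sum>j\<in>{1..<k}. \<beta> (k - j) * toeplitz_solution \<beta> u j x)) / \<beta> 0)"

declare toeplitz_solution.simps[simp del]

lemma toeplitz_solution_solves:
  assumes "\<beta> 0 \<noteq> 0" "1 \<le> k"
  shows "(\<Sum>j=1..k. \<beta> (k - j) * toeplitz_solution \<beta> u j x) = u k x"
proof -
  have "{1..k} = insert k {1..<k}" using assms by auto
  then have "(\<Sum>j=1..k. \<beta> (k - j) * toeplitz_solution \<beta> u j x)
      = \<beta> 0 * toeplitz_solution \<beta> u k x + (\<Sum>j\<in>{1..<k}. \<beta> (k - j) * toeplitz_solution \<beta> u j x)"
    by simp
  also have "\<dots> = u k x"
    using assms(1) by (subst toeplitz_solution.simps) simp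
  finally show ?thesis .
qed

lemma toeplitz_unique:
  fixes \<beta> f g :: "nat \<Rightarrow> real"
  assumes b: "\<beta> 0 \<noteq> 0"
    and eq: "\<And>k. 1 \<le> k \<Longrightarrow> k \<le> m \<Longrightarrow> (\<Sum>j=1..k. \<beta> (k - j) * f j) = (\<Sum>j=1..k. \<beta> (k - j) * g j)"
    and "1 \<le> k" "k \<le> m"
  shows "f k = g k"
  using assms(3,4)
proof (induction k rule: less_induct)
  case (less k)
  have "{1..k} = insert k {1..<k}" using less.prems by auto
  with eq[OF less.prems] have "\<beta> 0 * f k + (\<Sum>j\<in>{1..<k}. \<beta> (k - j) * f j)
      = \<beta> 0 * g k + (\<Sum>j\<in>{1..<k}. \<beta> (k - j) * g j)" by simp
  moreover have "(\<Sum>j\<in>{1..<k}. \<beta> (k - j) * f j) = (\<Sum>j\<in>{1..<k}. \<beta> (k - j) * g j)"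
    using less by (intro sum.cong) auto
  ultimately show ?case using b by simp
qed

context periodic_box
begin

lemma periodic_toeplitz_solution:
  assumes "\<And>j. 1 \<le> j \<Longrightarrow> j \<le> k \<Longrightarrow> periodic r (u j)" and "1 \<le> k"
  shows "periodic r (toeplitz_solution \<beta> u k)"
  using assms
proof (induction k rule: less_induct)
  case (less k)
  have "periodic r (\<lambda>x. \<Sum>j\<in>{1..<k}. \<beta> (k - j) * toeplitz_solution \<beta> u j x)"
    using less by (intro periodic_sum) auto
  from periodic_lincomb[OF less.prems(1)[of k] this, of "1 / \<beta> 0" "- 1 / \<beta> 0"] less.prems
  show ?case by (subst toeplitz_solution.simps) (simp add: diff_divide_distrib)
qed

text \<open>In each coordinate, subtract as many periods as fit between the lower face and the point.\<close>

lemma attains_value_in_box: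
  assumes per: "box_periodic a b f"
  shows "\<exists>y\<in>cbox a b. f y = f x"
proof -
  let ?l = "\<lambda>e. (b - a) \<bullet> e"
  have l: "0 < ?l e" if "e \<in> Basis" for e using nondegenerate[OF that] by (simp add: inner_diff_left)
  have nat: "f (x + (of_nat n * ?l e) *\<^sub>R e) = f x" if "e \<in> Basis" for n e x
  proof (induction n)
    case (Suc n)
    have "f (x + (of_nat (Suc n) * ?l e) *\<^sub>R e) = f (x + (of_nat n * ?l e) *\<^sub>R e + ?l e *\<^sub>R e)"
      by (simp add: algebra_simps)
    also have "\<dots> = f (x + (of_nat n * ?l e) *\<^sub>R e)" using per that by (simp add: box_periodic_def)
    finally show ?case using Suc by simp
  qed simp
  have int: "f (x + (of_int n * ?l e) *\<^sub>R e) = f x" if "e \<in> Basis" for n e x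
  proof (cases "0 \<le> n")
    case True then show ?thesis using nat[OF that, of x "nat n"] by simp
  next
    case False
    then show ?thesis using nat[OF that, of "x + (of_int n * ?l e) *\<^sub>R e" "nat (- n)"] by simp
  qed
  define m where "m e = - \<lfloor>(x \<bullet> e - a \<bullet> e) / ?l e\<rfloor>" for e
  have "f (x + (\<Sum>e\<in>B. (of_int (m e) * ?l e) *\<^sub>R e)) = f x" if "finite B" "B \<subseteq> Basis" for B
    using that
  proof (induction rule: finite_induct)
    case (insert e B)
    then show ?case
      using int[of e "x + (\<Sum>e\<in>B. (of_int (m e) * ?l e) *\<^sub>R e)" "m e"] by (simp add: algebra_simps)
  qed simp
  then have "f (x + (\<Sum>e\<in>Basis. (of_int (m e) * ?l e) *\<^sub>R e)) = f x" by simp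
  moreover have "x + (\<Sum>e\<in>Basis. (of_int (m e) * ?l e) *\<^sub>R e) \<in> cbox a b"
    unfolding mem_box
  proof
    fix e :: 'a assume e: "e \<in> Basis"
    define t where "t = (x \<bullet> e - a \<bullet> e) / ?l e"
    have tl: "t * ?l e = x \<bullet> e - a \<bullet> e" using l[OF e] by (simp add: t_def)
    have "(x + (\<Sum>e\<in>Basis. (of_int (m e) * ?l e) *\<^sub>R e)) \<bullet> e = x \<bullet> e + of_int (m e) * ?l e"
      using e by (simp add: inner_add_left)
    also have "\<dots> = a \<bullet> e + (t - of_int \<lfloor>t\<rfloor>) * ?l e"
      using tl by (simp add: m_def t_def[symmetric] left_diff_distrib)
    finally have eq: "(x + (\<Sum>e\<in>Basis. (of_int (m e) * ?l e) *\<^sub>R e)) \<bullet> e = a \<bullet> e + (t - of_int \<lfloor>t\<rfloor>) * ?l e" .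
    have "0 \<le> (t - of_int \<lfloor>t\<rfloor>) * ?l e"
      using l[OF e] by (intro mult_nonneg_nonneg) (auto simp: less_imp_le)
    moreover have "(t - of_int \<lfloor>t\<rfloor>) * ?l e \<le> 1 * ?l e"
      using l[OF e] by (intro mult_right_mono) linarith+
    ultimately show "a \<bullet> e \<le> (x + (\<Sum>e\<in>Basis. (of_int (m e) * ?l e) *\<^sub>R e)) \<bullet> e \<and>
        (x + (\<Sum>e\<in>Basis. (of_int (m e) * ?l e) *\<^sub>R e)) \<bullet> e \<le> b \<bullet> e"
      unfolding eq by (simp add: inner_diff_left)
  qed
  ultimately show ?thesis by blast
qed

lemma periodic_attains_max:
  assumes "periodic k f"
  obtains x where "\<And>y. f y \<le> f x"
proof -
  have "cbox a b \<noteq> {}" using nondegenerate by (simp add: box_ne_empty less_imp_le)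
  then obtain x where "\<forall>y\<in>cbox a b. f y \<le> f x"
    using continuous_attains_sup[OF compact_cbox _ periodic_imp_continuous[OF assms]] by blast
  then show ?thesis
    using attains_value_in_box[of f] assms that unfolding periodic_def by metis
qed

lemma abs_le_sup_norm:
  assumes "periodic k f"
  shows "\<bar>f x\<bar> \<le> sup_norm a b f"
proof -
  obtain y where y: "y \<in> cbox a b" "f y = f x"
    using attains_value_in_box[of f x] assms by (auto simp: periodic_def)
  have "compact ((\<lambda>x. \<bar>f x\<bar>) ` cbox a b)"
    using periodic_imp_continuous[OF assms] by (intro compact_continuous_image continuous_intros compact_cbox)
  then have "bdd_above ((\<lambda>x. \<bar>f x\<bar>) ` cbox a b)"
    by (intro bounded_imp_bdd_above compact_imp_bounded)
  from cSUP_upper[OF y(1) this] show ?thesis by (simp add: y sup_norm_def)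
qed

text \<open>At a maximum of \<open>u\<close> the Laplacian is nonpositive. The explicit terms enter through
  \<open>(S + 1) v - v\<^sup>3\<close>, and
  \<open>S - ((S + 1) v - v\<^sup>3) = (1 - v) (S - v - v\<^sup>2) \<ge> 0\<close> holds because \<open>v + v\<^sup>2 \<le> 2 \<le> S\<close>.\<close>

lemma implicit_step_le_1:
  assumes u: "periodic (Suc (Suc 0)) u" and "\<kappa> > 0" "\<gamma> > 0" and S: "S \<ge> 2"
    and H: "\<And>x. H x \<le> \<kappa>" and v: "\<And>x. \<bar>v x\<bar> \<le> 1"
    and eq: "\<And>x. \<kappa> * u x - H x = \<gamma> * (\<epsilon>\<^sup>2 * laplacian u x - (v x ^ 3 - v x) - S * (u x - v x))"
  shows "u x \<le> 1"
proof -
  obtain y where y: "\<And>z. u z \<le> u y" using periodic_attains_max[OF u] by blast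
  have "laplacian u y \<le> 0"
    using u y by (intro laplacian_le_0_at_max) (auto simp: periodic_def)
  then have lap: "\<epsilon>\<^sup>2 * laplacian u y \<le> 0" by (simp add: mult_nonneg_nonpos)
  have "0 \<le> (1 - v y) * (S - v y - (v y)\<^sup>2)"
    using v[of y] S abs_square_le_1[of "v y"] by (intro mult_nonneg_nonneg) auto
  then have "(S + 1) * v y - v y ^ 3 \<le> S"
    by (simp add: algebra_simps power2_eq_square power3_eq_cube)
  with lap have "\<epsilon>\<^sup>2 * laplacian u y - (v y ^ 3 - v y) - S * (u y - v y) \<le> S - S * u y"
    by (simp add: algebra_simps)
  then have "\<gamma> * (\<epsilon>\<^sup>2 * laplacian u y - (v y ^ 3 - v y) - S * (u y - v y)) \<le> \<gamma> * (S - S * u y)"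
    using \<open>\<gamma> > 0\<close> by (intro mult_left_mono) auto
  with eq[of y] H[of y] have "\<kappa> * u y \<le> \<kappa> + \<gamma> * (S - S * u y)" by linarith
  then have "(\<kappa> + \<gamma> * S) * u y \<le> (\<kappa> + \<gamma> * S) * 1" by (simp add: algebra_simps)
  moreover have "0 < \<kappa> + \<gamma> * S" using assms by (simp add: add_pos_pos)
  ultimately have "u y \<le> 1" by (rule mult_left_le_imp_le)
  then show ?thesis using y[of x] by linarith
qed

text \<open>The bound propagates by induction: the history term is controlled by \<open>L1_history_bounded\<close>. The
  scheme is odd in \<open>\<phi>\<close>, so the lower bound is the upper bound for \<open>- \<phi>\<close>.\<close>

lemma Allen_Cahn_max_principle:
  assumes \<alpha>: "0 < \<alpha>" "\<alpha> < 1" and dt: "0 < dt" and "\<gamma> > 0" and S: "S \<ge> 2"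
    and sol: "L1_scheme_solution a b Allen_Cahn \<alpha> \<gamma> \<epsilon> S dt N \<phi>"
    and init: "sup_norm a b (\<phi> 0) \<le> 1"
    and "n \<le> N"
  shows "\<bar>\<phi> n x\<bar> \<le> 1"
  using \<open>n \<le> N\<close>
proof (induction n arbitrary: x rule: less_induct)
  case (less n)
  have per: "periodic (Suc (Suc 0)) (\<phi> k)" if "k \<le> N" for k
    using sol that by (simp add: L1_scheme_solution_def periodic_def numeral_2_eq_2)
  show ?case
  proof (cases n)
    case 0
    then show ?thesis using abs_le_sup_norm[OF per[of 0], of x] init by simp
  next
    case (Suc m)
    let ?\<kappa> = "L1_coeff \<alpha> dt 0 / dt"
    let ?H = "\<lambda>x. ?\<kappa> * \<phi> n x - L1_caputo \<alpha> dt (\<lambda>k. \<phi> k x) n"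
    have k: "?\<kappa> > 0" using L1_coeff_pos \<alpha> dt by simp
    have H: "\<bar>?H x\<bar> \<le> ?\<kappa>" for x
      unfolding Suc using less Suc by (intro L1_history_bounded[OF \<alpha> dt]) auto
    have v: "\<bar>\<phi> m x\<bar> \<le> 1" for x using less Suc by simp
    have step: "L1_caputo \<alpha> dt (\<lambda>k. \<phi> k x) n
        = \<gamma> * (\<epsilon>\<^sup>2 * laplacian (\<phi> n) x - (\<phi> m x ^ 3 - \<phi> m x) - S * (\<phi> n x - \<phi> m x))" for x
      using sol less.prems Suc by (simp add: L1_scheme_solution_def chem_potential_def algebra_simps)
    have neg: "laplacian (\<lambda>x. - \<phi> n x) x = - laplacian (\<phi> n) x" for x
      using laplacian_lincomb[of "\<phi> n" "\<phi> n" "-1" 0 x] per[OF less.prems] by (simp add: periodic_def)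
    have pn: "periodic (Suc (Suc 0)) (\<lambda>x. - \<phi> n x)"
      using periodic_lincomb[OF per per, of n n "-1" 0] less.prems by simp
    have "\<phi> n x \<le> 1"
    proof (rule implicit_step_le_1[where v = "\<phi> m" and H = ?H and \<epsilon> = \<epsilon>, OF per k \<open>\<gamma> > 0\<close> S])
      show "?H x \<le> ?\<kappa>" for x using H[of x] by linarith
    qed (use v step less.prems in auto)
    moreover have "- \<phi> n x \<le> 1"
    proof (rule implicit_step_le_1[where u = "\<lambda>x. - \<phi> n x" and v = "\<lambda>x. - \<phi> m x" and H = "\<lambda>x. - ?H x" and \<epsilon> = \<epsilon>, OF pn k \<open>\<gamma> > 0\<close> S])
      show "- ?H x \<le> ?\<kappa>" for x using H[of x] by linarith
      show "?\<kappa> * - \<phi> n x - - ?H x = \<gamma> * (\<epsilon>\<^sup>2 * laplacian (\<lambda>x. - \<phi> n x) x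
          - ((- \<phi> m x) ^ 3 - - \<phi> m x) - S * (- \<phi> n x - - \<phi> m x))" for x
        by (simp add: step neg algebra_simps)
    qed (use v in auto)
    ultimately show ?thesis by linarith
  qed
qed

lemma weighted_L1_form_ip_nonneg:
  assumes \<alpha>: "0 < \<alpha>" "\<alpha> < 1" and dt: "0 < dt"
    and y: "\<And>k. 1 \<le> k \<Longrightarrow> k \<le> m \<Longrightarrow> continuous_on UNIV (y k)"
  shows "0 \<le> (\<Sum>k=1..m. (real k * dt) powr \<alpha> * L1_coeff \<alpha> dt (m - k)
      * (\<Sum>j=1..k. L1_coeff \<alpha> dt (k - j) * (y k \<bullet>\<^sub>2 y j)))"
proof -
  let ?c = "\<lambda>k j. (real k * dt) powr \<alpha> * L1_coeff \<alpha> dt (m - k) * L1_coeff \<alpha> dt (k - j)"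
  have c: "continuous_on UNIV (\<lambda>x. ?c k j * y k x * y j x)" if "k \<in> {1..m}" "j \<in> {1..k}" for k j
    using that by (intro continuous_intros y) auto
  have "0 \<le> integral (cbox a b) (\<lambda>x. \<Sum>k=1..m. \<Sum>j=1..k. ?c k j * y k x * y j x)"
    using weighted_L1_form_nonneg[OF \<alpha> dt]
    by (intro integral_nonneg integrable_of_continuous continuous_on_sum c)
  also have "\<dots> = (\<Sum>k=1..m. \<Sum>j=1..k. integral (cbox a b) (\<lambda>x. ?c k j * y k x * y j x))"
    by (subst integral_sum, simp, intro integrable_of_continuous continuous_on_sum c, simp_all)
       (intro sum.cong refl integral_sum integrable_of_continuous c, auto)
  also have "\<dots> = (\<Sum>k=1..m. \<Sum>j=1..k. ?c k j * (y k \<bullet>\<^sub>2 y j))"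
    by (simp add: l2_inner_def mult.assoc)
  finally show ?thesis by (simp add: sum_distrib_left mult.assoc)
qed

end

section \<open>Dissipation of the weighted energy\<close>

context periodic_box
begin

text \<open>Covers the models with \<open>\<G> = -1\<close>: here \<open>\<mu>\<^sup>k\<close> is a negative multiple of the L1 derivative, and
  substituting it leaves the quadratic form in the increments.\<close>

lemma dissipation_L2_gradient_flow:
  assumes \<alpha>: "0 < \<alpha>" "\<alpha> < 1" and dt: "0 < dt" and c: "0 < c"
    and \<delta>: "\<And>k. 1 \<le> k \<Longrightarrow> k \<le> m \<Longrightarrow> continuous_on UNIV (\<delta> k)"
    and eq: "\<And>k x. 1 \<le> k \<Longrightarrow> k \<le> m \<Longrightarrow>
      (\<Sum>j=1..k. L1_coeff \<alpha> dt (k - j) * \<delta> j x) = c * - \<mu> k x"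
  shows "(\<Sum>k=1..m. (real k * dt) powr \<alpha> * L1_coeff \<alpha> dt (m - k) * (\<delta> k \<bullet>\<^sub>2 \<mu> k)) \<le> 0"
proof -
  have "\<delta> k \<bullet>\<^sub>2 \<mu> k = - (1 / c) * (\<Sum>j=1..k. L1_coeff \<alpha> dt (k - j) * (\<delta> k \<bullet>\<^sub>2 \<delta> j))"
    if k: "1 \<le> k" "k \<le> m" for k
  proof -
    have "\<mu> k = (\<lambda>x. - (1 / c) * (\<Sum>j=1..k. L1_coeff \<alpha> dt (k - j) * \<delta> j x))"
      using eq[OF k] c by (simp add: fun_eq_iff)
    then have "\<delta> k \<bullet>\<^sub>2 \<mu> k = - (1 / c) * (\<delta> k \<bullet>\<^sub>2 (\<lambda>x. \<Sum>j=1..k. L1_coeff \<alpha> dt (k - j) * \<delta> j x))"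
      by (simp only: ip_cmult_right)
    also have "\<delta> k \<bullet>\<^sub>2 (\<lambda>x. \<Sum>j=1..k. L1_coeff \<alpha> dt (k - j) * \<delta> j x)
        = (\<Sum>j=1..k. \<delta> k \<bullet>\<^sub>2 (\<lambda>x. L1_coeff \<alpha> dt (k - j) * \<delta> j x))"
      using k by (intro ip_sum_right continuous_on_mult continuous_on_const \<delta>) auto
    finally show ?thesis by (simp only: ip_cmult_right)
  qed
  then have "(\<Sum>k=1..m. (real k * dt) powr \<alpha> * L1_coeff \<alpha> dt (m - k) * (\<delta> k \<bullet>\<^sub>2 \<mu> k))
      = - (1 / c) * (\<Sum>k=1..m. (real k * dt) powr \<alpha> * L1_coeff \<alpha> dt (m - k)
          * (\<Sum>j=1..k. L1_coeff \<alpha> dt (k - j) * (\<delta> k \<bullet>\<^sub>2 \<delta> j)))"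
    by (simp add: sum_distrib_left mult_ac sum_negf)
  also have "\<dots> \<le> 0"
    using weighted_L1_form_ip_nonneg[OF \<alpha> dt \<delta>] c by (intro mult_nonpos_nonneg) auto
  finally show ?thesis .
qed

text \<open>Covers \<open>\<G> = \<Delta>\<close>. Let \<open>\<psi>\<close> solve the Toeplitz system with right-hand side \<open>c \<mu>\<close>. Applying the Laplacian
  to the system gives the system satisfied by \<open>\<delta>\<close>, so \<open>\<delta>\<^sup>k = \<Delta>\<psi>\<^sup>k\<close> by uniqueness. Then
  \<open>\<langle>\<delta>\<^sup>k, \<mu>\<^sup>k\<rangle> = - \<langle>\<nabla>\<psi>\<^sup>k, \<nabla>\<mu>\<^sup>k\<rangle>\<close>, and expanding \<open>\<mu>\<^sup>k\<close> in the \<open>\<psi>\<^sup>j\<close> gives the quadratic form once per coordinate.\<close>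

lemma dissipation_mass_conserving_flow:
  assumes \<alpha>: "0 < \<alpha>" "\<alpha> < 1" and dt: "0 < dt" and c: "0 < c"
    and \<mu>: "\<And>k. 1 \<le> k \<Longrightarrow> k \<le> m \<Longrightarrow> periodic (Suc (Suc 0)) (\<mu> k)"
    and eq: "\<And>k x. 1 \<le> k \<Longrightarrow> k \<le> m \<Longrightarrow>
      (\<Sum>j=1..k. L1_coeff \<alpha> dt (k - j) * \<delta> j x) = c * laplacian (\<mu> k) x"
  shows "(\<Sum>k=1..m. (real k * dt) powr \<alpha> * L1_coeff \<alpha> dt (m - k) * (\<delta> k \<bullet>\<^sub>2 \<mu> k)) \<le> 0"
proof -
  let ?b = "L1_coeff \<alpha> dt"
  have b0: "?b 0 \<noteq> 0" using L1_coeff_pos[OF \<alpha>(2) dt, of 0] by simp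
  define \<psi> where "\<psi> = toeplitz_solution ?b (\<lambda>k x. c * \<mu> k x)"
  have \<psi>: "periodic (Suc (Suc 0)) (\<psi> k)" if "1 \<le> k" "k \<le> m" for k
    unfolding \<psi>_def using periodic_lincomb[OF \<mu> \<mu>, of _ _ c 0] that
    by (intro periodic_toeplitz_solution) auto
  have sol: "(\<Sum>j=1..k. ?b (k - j) * \<psi> j x) = c * \<mu> k x" if "1 \<le> k" for k x
    unfolding \<psi>_def using b0 that by (rule toeplitz_solution_solves)
  have \<mu>_eq: "\<mu> k = (\<lambda>x. \<Sum>j=1..k. (?b (k - j) / c) * \<psi> j x)" if "1 \<le> k" for k
    using sol[OF that] c by (simp add: fun_eq_iff sum_divide_distrib[symmetric])
  have lap: "\<delta> k x = laplacian (\<psi> k) x" if k: "1 \<le> k" "k \<le> m" for k x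
  proof (rule toeplitz_unique[where \<beta> = ?b and m = m and f = "\<lambda>j. \<delta> j x" and g = "\<lambda>j. laplacian (\<psi> j) x", OF b0 _ k])
    fix i assume i: "1 \<le> i" "i \<le> m"
    have "laplacian (\<mu> i) x = (\<Sum>j=1..i. (?b (i - j) / c) * laplacian (\<psi> j) x)"
      unfolding \<mu>_eq[OF i(1)] using i \<psi> by (intro laplacian_sum) (auto simp: periodic_def)
    then have "c * laplacian (\<mu> i) x = (\<Sum>j=1..i. ?b (i - j) * laplacian (\<psi> j) x)"
      using c by (simp add: sum_distrib_left)
    with eq[OF i] show "(\<Sum>j=1..i. ?b (i - j) * \<delta> j x) = (\<Sum>j=1..i. ?b (i - j) * laplacian (\<psi> j) x)"
      by simp
  qed
  have \<psi>c: "continuous_on UNIV (partial e (\<psi> k))" if "e \<in> Basis" "1 \<le> k" "k \<le> m" for e k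
    using \<psi> that by (intro periodic_imp_continuous periodic_partial)
  have "\<delta> k \<bullet>\<^sub>2 \<mu> k = - (1 / c) * (\<Sum>e\<in>Basis. \<Sum>j=1..k. ?b (k - j) * (partial e (\<psi> k) \<bullet>\<^sub>2 partial e (\<psi> j)))"
    if k: "1 \<le> k" "k \<le> m" for k
  proof -
    have "\<delta> k = laplacian (\<psi> k)" using lap[OF k] by (simp add: fun_eq_iff)
    then have "\<delta> k \<bullet>\<^sub>2 \<mu> k = \<mu> k \<bullet>\<^sub>2 laplacian (\<psi> k)" by (simp add: ip_commute)
    also have "\<dots> = - (\<Sum>e\<in>Basis. partial e (\<mu> k) \<bullet>\<^sub>2 partial e (\<psi> k))"
      using \<mu>[OF k] \<psi>[OF k] periodic_le[of _ "\<mu> k" "Suc 0"] by (intro ip_laplacian) auto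
    also have "(\<Sum>e\<in>Basis. partial e (\<mu> k) \<bullet>\<^sub>2 partial e (\<psi> k))
        = (\<Sum>e\<in>Basis. 1 / c * (\<Sum>j=1..k. ?b (k - j) * (partial e (\<psi> k) \<bullet>\<^sub>2 partial e (\<psi> j))))"
    proof (rule sum.cong)
      fix e :: 'a assume e: "e \<in> Basis"
      have "partial e (\<mu> k) = (\<lambda>x. \<Sum>j=1..k. (?b (k - j) / c) * partial e (\<psi> j) x)"
        unfolding \<mu>_eq[OF k(1)] fun_eq_iff using \<psi> k
        by (intro allI partial_sum Ck_imp_differentiable[of "Suc (Suc 0)"]) (auto simp: periodic_def)
      then have "partial e (\<mu> k) \<bullet>\<^sub>2 partial e (\<psi> k)
          = partial e (\<psi> k) \<bullet>\<^sub>2 (\<lambda>x. \<Sum>j=1..k. (?b (k - j) / c) * partial e (\<psi> j) x)"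
        by (simp add: ip_commute)
      also have "\<dots> = (\<Sum>j=1..k. partial e (\<psi> k) \<bullet>\<^sub>2 (\<lambda>x. (?b (k - j) / c) * partial e (\<psi> j) x))"
        using k e by (intro ip_sum_right continuous_on_mult continuous_on_const \<psi>c) auto
      also have "\<dots> = (\<Sum>j=1..k. (?b (k - j) / c) * (partial e (\<psi> k) \<bullet>\<^sub>2 partial e (\<psi> j)))"
        by (simp only: ip_cmult_right)
      finally show "partial e (\<mu> k) \<bullet>\<^sub>2 partial e (\<psi> k)
          = 1 / c * (\<Sum>j=1..k. ?b (k - j) * (partial e (\<psi> k) \<bullet>\<^sub>2 partial e (\<psi> j)))"
        by (simp add: sum_distrib_left)
    qed simp
    finally show ?thesis by (simp add: sum_distrib_left sum_negf)
  qed
  then have "(\<Sum>k=1..m. (real k * dt) powr \<alpha> * ?b (m - k) * (\<delta> k \<bullet>\<^sub>2 \<mu> k))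
      = (\<Sum>k=1..m. \<Sum>e\<in>Basis. - (1 / c) * ((real k * dt) powr \<alpha> * ?b (m - k)
          * (\<Sum>j=1..k. ?b (k - j) * (partial e (\<psi> k) \<bullet>\<^sub>2 partial e (\<psi> j)))))"
    by (simp add: sum_distrib_left mult_ac sum_negf)
  also have "\<dots> = (\<Sum>e\<in>Basis. - (1 / c) * (\<Sum>k=1..m. (real k * dt) powr \<alpha> * ?b (m - k)
          * (\<Sum>j=1..k. ?b (k - j) * (partial e (\<psi> k) \<bullet>\<^sub>2 partial e (\<psi> j)))))"
    by (subst sum.swap) (simp only: sum_distrib_left)
  also have "\<dots> \<le> 0"
    using weighted_L1_form_ip_nonneg[OF \<alpha> dt \<psi>c] c
    by (intro sum_nonpos mult_nonpos_nonneg) auto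
  finally show ?thesis .
qed

lemma periodic_chem_potential_CH:
  assumes "periodic 2 (\<phi> n)" "periodic 2 (\<phi> (Suc n))"
    and "Ck 2 (chem_potential (Cahn_Hilliard F L) \<epsilon> S \<phi> n)"
  shows "periodic (Suc (Suc 0)) (chem_potential (Cahn_Hilliard F L) \<epsilon> S \<phi> n)"
  using assms periodic_laplacian[of 0 "\<phi> (Suc n)"]
  by (auto simp: periodic_def numeral_2_eq_2 chem_potential_def box_periodic_def)

lemma scheme_dissipation:
  assumes \<alpha>: "0 < \<alpha>" "\<alpha> < 1" and dt: "0 < dt" and \<gamma>: "\<gamma> > 0"
    and sol: "L1_scheme_solution a b M \<alpha> \<gamma> \<epsilon> S dt N \<phi>" and "m \<le> N"
  shows "(\<Sum>k=1..m. (real k * dt) powr \<alpha> * L1_coeff \<alpha> dt (m - k)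
      * ((\<lambda>x. \<phi> k x - \<phi> (k - 1) x) \<bullet>\<^sub>2 chem_potential M \<epsilon> S \<phi> (k - 1))) \<le> 0"
proof -
  have per: "periodic (order_L M) (\<phi> k)" if "k \<le> N" for k
    using sol that by (simp add: L1_scheme_solution_def periodic_def)
  have eq: "(\<Sum>j=1..k. L1_coeff \<alpha> dt (k - j) * (\<phi> j x - \<phi> (j - 1) x))
      = \<gamma> * dt * op_G M (chem_potential M \<epsilon> S \<phi> (k - 1)) x" if "1 \<le> k" "k \<le> m" for k x
  proof -
    have "L1_caputo \<alpha> dt (\<lambda>k. \<phi> k x) (Suc (k - 1)) = \<gamma> * op_G M (chem_potential M \<epsilon> S \<phi> (k - 1)) x"
      using sol that \<open>m \<le> N\<close> by (simp add: L1_scheme_solution_def del: Suc_pred)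
    then show ?thesis
      using that dt by (simp add: L1_caputo_def bdiff_def sum_divide_distrib[symmetric] field_simps)
  qed
  have dc: "continuous_on UNIV (\<lambda>x. \<phi> k x - \<phi> (k - 1) x)" if "1 \<le> k" "k \<le> m" for k
    using per[of k] per[of "k - 1"] that \<open>m \<le> N\<close>
    by (intro continuous_on_diff periodic_imp_continuous[of "order_L M"]) auto
  have c: "0 < \<gamma> * dt" using \<gamma> dt by simp
  consider (neg) "\<And>(f :: 'a \<Rightarrow> real) x. op_G M f x = - f x" | (CH) F L where "M = Cahn_Hilliard F L"
    by (cases M) auto
  then show ?thesis
  proof cases
    case neg
    then show ?thesis
      using eq by (intro dissipation_L2_gradient_flow[OF \<alpha> dt c dc]) auto
  next
    case CH
    have "periodic (Suc (Suc 0)) (chem_potential M \<epsilon> S \<phi> (k - 1))" if "1 \<le> k" "k \<le> m" for k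
      using per[of k] per[of "k - 1"] sol that \<open>m \<le> N\<close> unfolding CH
      by (intro periodic_chem_potential_CH) (auto simp: L1_scheme_solution_def)
    then show ?thesis
      using eq by (intro dissipation_mass_conserving_flow[OF \<alpha> dt c]) (auto simp: CH)
  qed
qed

lemma weighted_D_nonpos:
  assumes \<alpha>: "0 < \<alpha>" "\<alpha> < 1" and dt: "0 < dt" and \<gamma>: "\<gamma> > 0"
    and adm: "admissible M S"
    and sol: "L1_scheme_solution a b M \<alpha> \<gamma> \<epsilon> S dt N \<phi>"
    and init: "M = Allen_Cahn \<Longrightarrow> sup_norm a b (\<phi> 0) \<le> 1"
    and "m \<le> N"
  shows "weighted_D \<alpha> dt (\<lambda>n. energy a b M \<epsilon> (\<phi> n)) m \<le> 0"
proof -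
  let ?E = "\<lambda>n. energy a b M \<epsilon> (\<phi> n)"
  let ?w = "\<lambda>k. (real k * dt) powr \<alpha> * L1_coeff \<alpha> dt (m - k)"
  have step: "?E k - ?E (k - 1) \<le> (\<lambda>x. \<phi> k x - \<phi> (k - 1) x) \<bullet>\<^sub>2 chem_potential M \<epsilon> S \<phi> (k - 1)"
    if k: "1 \<le> k" "k \<le> m" for k
  proof -
    have "Suc (k - 1) = k" using k by simp
    moreover have "\<bar>\<phi> i x\<bar> \<le> 1" if "M = Allen_Cahn" "i \<le> N" for i x
      using that adm sol init
      by (intro Allen_Cahn_max_principle[OF \<alpha> dt \<gamma>, of S \<epsilon> N]) auto
    ultimately show ?thesis
      using energy_le[OF adm, of \<phi> "k - 1" \<epsilon>] sol k \<open>m \<le> N\<close>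
      by (simp add: L1_scheme_solution_def periodic_def)
  qed
  have "(\<Sum>k=1..m. ?w k * (?E k - ?E (k - 1)))
      \<le> (\<Sum>k=1..m. ?w k * ((\<lambda>x. \<phi> k x - \<phi> (k - 1) x) \<bullet>\<^sub>2 chem_potential M \<epsilon> S \<phi> (k - 1)))"
    using step L1_coeff_pos[OF \<alpha>(2) dt]
    by (intro sum_mono mult_left_mono) (auto simp: less_imp_le)
  also have "\<dots> \<le> 0"
    using \<alpha> dt \<gamma> sol \<open>m \<le> N\<close> by (rule scheme_dissipation)
  finally have "(\<Sum>k=1..m. ?w k * (?E k - ?E (k - 1))) / dt \<le> 0"
    using dt by (simp add: divide_nonpos_pos)
  then have "(\<Sum>k=1..m. ?w k * bdiff dt ?E k) \<le> 0"
    by (simp add: bdiff_def sum_divide_distrib)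
  then show ?thesis
    unfolding weighted_D_def using \<alpha> dt
    by (intro mult_nonneg_nonpos) (auto simp: Gamma_real_pos less_imp_le)
qed

end

theorem theorem2p2:
  fixes a b :: "'a::euclidean_space"
    and \<alpha> \<gamma> \<epsilon> T S dt :: real
    and N :: nat
    and M :: model
    and \<phi> :: "nat \<Rightarrow> 'a \<Rightarrow> real"
    and E :: "nat \<Rightarrow> real"
  assumes "\<forall>e\<in>Basis. a \<bullet> e < b \<bullet> e"
    and "0 < \<alpha>" and "\<alpha> < 1"
    and "\<gamma> > 0" and "\<epsilon> > 0" and "T > 0" and "N \<ge> 1"
    and "dt = T / real N"
    and "admissible M S"
    and "L1_scheme_solution a b M \<alpha> \<gamma> \<epsilon> S dt N \<phi>"
    and "M = Allen_Cahn \<Longrightarrow> sup_norm a b (\<phi> 0) \<le> 1"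
    and "\<And>n. E n = energy a b M \<epsilon> (\<phi> n)"
  shows "\<forall>n\<in>{1..N}. weighted_energy \<alpha> dt E n \<le> weighted_energy \<alpha> dt E (n - 1)"
proof
  interpret periodic_box a b by standard (use assms(1) in auto)
  have dt: "0 < dt" using assms by simp
  have E: "E = (\<lambda>n. energy a b M \<epsilon> (\<phi> n))" using assms(12) by (simp add: fun_eq_iff)
  fix n assume n: "n \<in> {1..N}"
  then have "weighted_D \<alpha> dt E n \<le> 0"
    unfolding E using assms dt by (intro weighted_D_nonpos) auto
  moreover from n obtain k where "n = Suc k" by (cases n) auto
  then have "weighted_energy \<alpha> dt E n = weighted_energy \<alpha> dt E (n - 1) + dt * weighted_D \<alpha> dt E n"
    by (simp add: weighted_energy_def algebra_simps)
  ultimately show "weighted_energy \<alpha> dt E n \<le> weighted_energy \<alpha> dt E (n - 1)"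
    using dt by (simp add: mult_nonneg_nonpos)
qed

end
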